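(* Let $\Delta$ be a bi-Cohen-Macaulay simplicial complex of type $(n,1,s)$ which is not a cone. Then $n-s\le s-2$.
   Context: Let $k$ be a field. A simplicial complex on $[n]=\{1,\dots,n\}$ is a family of subsets of $[n]$ (faces) closed under taking subsets; a face of cardinality $r$ has dimension $r-1$. $\Delta$ is Cohen-Macaulay (over $k$) if its Stanley-Reisner ring $k[\Delta]=k[x_1,\dots,x_n]/(x_{i_1}\cdots x_{i_r} : \{i_1,\dots,i_r\}\notin\Delta)$ is a Cohen-Macaulay ring. The Alexander dual is $\Delta^*=\{F\subseteq[n] : [n]\setminus F\notin\Delta\}$. $\Delta$ is bi-Cohen-Macaulay if both $\Delta$ and $\Delta^*$ are Cohen-Macaulay. A bi-Cohen-Macaulay complex $\Delta$ on $[n]$ is of type $(n,c,s)$ if $c$ is the largest integer such that all subsets of $[n]$ of cardinality $c$ are in $\Delta$, and the $f$-polynomial $f_\Delta(t)=1+f_0t+\cdots+f_{d-1}t^d$ ($f_i$ the number of $i$-dimensional faces, $d-1=\dim\Delta$) equals $(1+t)^{n-s}\left(1+st+\binom s2t^2+\cdots+\binom sct^c\right)$. $\Delta$ is a cone if there is a vertex $i\in[n]$ such that $F\in\Delta$ implies $F\cup\{i\}\in\Delta$. *)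

theory Defs
  imports
    "HOL-Algebra.QuotRing"
    "HOL-Algebra.Ring_Divisibility"
    "HOL-Library.Poly_Mapping"
    "HOL-Library.Extended_Nat"
    "HOL-Computational_Algebra.Polynomial"
begin

section \<open>Cohen-Macaulay rings\<close>

text \<open>
  \<open>x\<^sub>0, \<dots>, x\<^sub>r\<^sub>-\<^sub>1\<close> is an \<open>R\<close>-sequence if it generates a proper ideal and each \<open>x\<^sub>i\<close> is a
  nonzerodivisor on \<open>R / (x\<^sub>0, \<dots>, x\<^sub>i\<^sub>-\<^sub>1)\<close>; the latter is spelled out in \<open>R\<close>.
\<close>

definition regular_sequence :: "('a, 'b) ring_scheme \<Rightarrow> 'a list \<Rightarrow> bool" where
  "regular_sequence R xs \<longleftrightarrow>
     set xs \<subseteq> carrier R \<and>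
     Idl\<^bsub>R\<^esub> (set xs) \<noteq> carrier R \<and>
     (\<forall>i < length xs. \<forall>r \<in> carrier R.
        xs ! i \<otimes>\<^bsub>R\<^esub> r \<in> Idl\<^bsub>R\<^esub> (set (take i xs)) \<longrightarrow> r \<in> Idl\<^bsub>R\<^esub> (set (take i xs)))"

definition ideal_depth :: "('a, 'b) ring_scheme \<Rightarrow> 'a set \<Rightarrow> enat" where
  "ideal_depth R I = Sup {enat (length xs) | xs. regular_sequence R xs \<and> set xs \<subseteq> I}"

text \<open>
  The codimension (height) of a prime \<open>P\<close>, that is, the Krull dimension of the local ring \<open>R\<^sub>P\<close>.
\<close>

definition prime_codim :: "('a, 'b) ring_scheme \<Rightarrow> 'a set \<Rightarrow> enat" where
  "prime_codim R P =
     Sup {enat r | r. \<exists>Q. (\<forall>i \<le> r. primeideal (Q i) R) \<and> (\<forall>i < r. Q i \<subset> Q (Suc i)) \<and> Q r = P}"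

text \<open>
  Definition as in Eisenbud, Commutative Algebra with a View Toward Algebraic Geometry, Section
  18.2 (and Kaplansky, Commutative Rings, Section 3-1). For a maximal ideal \<open>P\<close> of a Noetherian
  ring, the depth of \<open>P\<close> on \<open>R\<close> is the depth of the local ring \<open>R\<^sub>P\<close>, so this asks that \<open>R\<^sub>P\<close> be
  Cohen-Macaulay for every maximal \<open>P\<close>. The zero ring qualifies.
\<close>

definition cohen_macaulay_ring :: "('a, 'b) ring_scheme \<Rightarrow> bool" where
  "cohen_macaulay_ring R \<longleftrightarrow>
     cring R \<and> noetherian_ring R \<and> (\<forall>P. maximalideal P R \<longrightarrow> ideal_depth R P = prime_codim R P)"

section \<open>Stanley-Reisner rings\<close>

text \<open>
  Monomials are finitely supported exponent vectors \<open>nat \<Rightarrow>\<^sub>0 nat\<close>, and polynomials are finitely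
  supported maps from monomials to coefficients, with the convolution product of
  \<^theory>\<open>HOL-Library.Poly_Mapping\<close>. The ring below is \<open>k[x\<^sub>1, \<dots>, x\<^sub>n]\<close>.
\<close>

type_synonym 'k mpolynomial = "(nat \<Rightarrow>\<^sub>0 nat) \<Rightarrow>\<^sub>0 'k"

definition mpoly_ring :: "nat \<Rightarrow> 'k::field mpolynomial ring" where
  "mpoly_ring n =
     \<lparr>carrier = {p. \<forall>m \<in> Poly_Mapping.keys p. Poly_Mapping.keys m \<subseteq> {1..n}},
      monoid.mult = (*), one = 1, zero = 0, add = (+)\<rparr>"

definition mpoly_var :: "nat \<Rightarrow> 'k::field mpolynomial" where
  "mpoly_var i = Poly_Mapping.single (Poly_Mapping.single i 1) 1"

definition stanley_reisner_ideal :: "nat \<Rightarrow> nat set set \<Rightarrow> 'k::field mpolynomial set" where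
  "stanley_reisner_ideal n \<Delta> =
     Idl\<^bsub>mpoly_ring n\<^esub> {\<Prod>i\<in>F. mpoly_var i | F. F \<subseteq> {1..n} \<and> F \<notin> \<Delta>}"

definition stanley_reisner_ring :: "nat \<Rightarrow> nat set set \<Rightarrow> 'k::field mpolynomial set ring" where
  "stanley_reisner_ring n \<Delta> = mpoly_ring n Quot stanley_reisner_ideal n \<Delta>"

section \<open>Simplicial complexes\<close>

text \<open>
  A simplicial complex need not contain every singleton \<open>{i}\<close>, and the empty family is allowed
  (it is the Alexander dual of the full simplex).
\<close>

definition simplicial_complex :: "nat \<Rightarrow> nat set set \<Rightarrow> bool" where
  "simplicial_complex n \<Delta> \<longleftrightarrow> \<Delta> \<subseteq> Pow {1..n} \<and> (\<forall>F \<in> \<Delta>. \<forall>G. G \<subseteq> F \<longrightarrow> G \<in> \<Delta>)"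

definition alexander_dual :: "nat \<Rightarrow> nat set set \<Rightarrow> nat set set" where
  "alexander_dual n \<Delta> = {F. F \<subseteq> {1..n} \<and> {1..n} - F \<notin> \<Delta>}"

text \<open>The argument \<^typ>\<open>'k itself\<close> carries the ground field.\<close>

definition cohen_macaulay_complex :: "'k::field itself \<Rightarrow> nat \<Rightarrow> nat set set \<Rightarrow> bool" where
  "cohen_macaulay_complex _ n \<Delta> \<longleftrightarrow>
     simplicial_complex n \<Delta> \<and>
     cohen_macaulay_ring (stanley_reisner_ring n \<Delta> :: 'k mpolynomial set ring)"

definition bi_cohen_macaulay :: "'k::field itself \<Rightarrow> nat \<Rightarrow> nat set set \<Rightarrow> bool" where
  "bi_cohen_macaulay K n \<Delta> \<longleftrightarrow>
     cohen_macaulay_complex K n \<Delta> \<and> cohen_macaulay_complex K n (alexander_dual n \<Delta>)"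

text \<open>
  The coefficient of \<open>t^r\<close> counts the faces of cardinality \<open>r\<close>, that is, of dimension \<open>r - 1\<close>; the
  constant term 1 counts the empty face. Terms beyond the dimension vanish.
\<close>

definition f_polynomial :: "nat \<Rightarrow> nat set set \<Rightarrow> int poly" where
  "f_polynomial n \<Delta> = (\<Sum>r\<le>n. monom (int (card {F \<in> \<Delta>. card F = r})) r)"

definition full_skeleton_sizes :: "nat \<Rightarrow> nat set set \<Rightarrow> nat set" where
  "full_skeleton_sizes n \<Delta> = {c. c \<le> n \<and> (\<forall>F. F \<subseteq> {1..n} \<and> card F = c \<longrightarrow> F \<in> \<Delta>)}"

text \<open>
  The bound \<open>s \<le> n\<close> is what makes \<open>(1 + t)^(n - s)\<close> a polynomial; it keeps the truncated
  subtraction below exact.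
\<close>

definition bi_cohen_macaulay_of_type ::
  "'k::field itself \<Rightarrow> nat set set \<Rightarrow> nat \<Rightarrow> nat \<Rightarrow> nat \<Rightarrow> bool" where
  "bi_cohen_macaulay_of_type K \<Delta> n c s \<longleftrightarrow>
     bi_cohen_macaulay K n \<Delta> \<and>
     c \<in> full_skeleton_sizes n \<Delta> \<and> (\<forall>c' \<in> full_skeleton_sizes n \<Delta>. c' \<le> c) \<and>
     s \<le> n \<and>
     f_polynomial n \<Delta> = [:1, 1:] ^ (n - s) * (\<Sum>i\<le>c. monom (int (s choose i)) i)"

definition is_cone :: "nat \<Rightarrow> nat set set \<Rightarrow> bool" where
  "is_cone n \<Delta> \<longleftrightarrow> (\<exists>i \<in> {1..n}. \<forall>F \<in> \<Delta>. F \<union> {i} \<in> \<Delta>)"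

end

theory Submission
  imports Defs
begin

text \<open>
  A Cohen-Macaulay complex is pure and connected in codimension one. The \<open>f\<close>-polynomial
  says that \<open>\<Delta>\<close> has dimension \<open>n - s\<close> and \<open>s\<close> faces of that dimension. Order the facets so
  that each one meets an earlier one in codimension one. Then every
  facet after the first removes at most one vertex from the common intersection, which therefore has
  at least \<open>(n - s + 1) - (s - 1)\<close> elements. It is empty because \<open>\<Delta>\<close> is not a cone.

  Connectedness comes from localising at a point. If some link \<open>lk \<sigma>\<close> of dimension at least one were
  disconnected, consider the maximal ideal of the indicator point of \<open>\<sigma>\<close>. Its height, and so its
  depth, is at least \<open>|\<sigma>| + 2\<close>, hence the Koszul cohomology of \<open>k[\<Delta>]\<close> at this point vanishes up to
  degree \<open>|\<sigma>| + 1\<close>. Dividing by the nonzerodivisors \<open>x\<^sub>i - 1\<close>, \<open>i \<in> \<sigma>\<close>, leaves the link and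
  vanishing in degree one, but the disconnection gives a nontrivial cocycle there.
\<close>

section \<open>Depth and acyclicity\<close>

text \<open>The definition of Cohen-Macaulayness tests maximal ideals only, so a link has to be seen
  at a point: near the indicator point of \<sigma> the variables of \<sigma> are invertible. The
  regular sequence that depth supplies consists of unknown elements of the maximal ideal, whereas
  the disconnection cocycle is written in the coordinates. Koszul cohomology on the generators x_i -
  c_i mediates, because any regular sequence of length m inside the ideal they generate kills the
  degrees below m. Every division by some x_i - 1 then costs one degree, which is why codimension
  two is the threshold. All cochains take values in the polynomial ring and all quotients are
  congruences modulo its ideals, so passing from k[\<Delta>] to a link only enlarges the ideal.
  Purity comes out of the ordering of the facets: the disconnection argument compares facets of
  maximal size with arbitrary other facets, and so forces the next facet to have maximal size
  too.\<close>

locale subring_class =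
  fixes C :: "'a::comm_ring_1 set"
  assumes one_closed [simp]: "1 \<in> C"
    and diff_closed [simp]: "\<And>a b. a \<in> C \<Longrightarrow> b \<in> C \<Longrightarrow> a - b \<in> C"
    and mult_closed [simp]: "\<And>a b. a \<in> C \<Longrightarrow> b \<in> C \<Longrightarrow> a * b \<in> C"
begin

lemma zero_closed [simp]: "0 \<in> C"
  using diff_closed[of 1 1] by simp

lemma uminus_closed [simp]: "a \<in> C \<Longrightarrow> - a \<in> C"
  using diff_closed[of 0 a] by simp

lemma add_closed [simp]: "a \<in> C \<Longrightarrow> b \<in> C \<Longrightarrow> a + b \<in> C"
  using diff_closed[of a "- b"] by simp

lemma sum_closed: "(\<And>i. i \<in> A \<Longrightarrow> f i \<in> C) \<Longrightarrow> sum f A \<in> C"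
  by (induction A rule: infinite_finite_induct) auto

text \<open>Ideals of \<open>C\<close> in type-class arithmetic, so that the Koszul computations are
  open to \<open>algebra_simps\<close>. The bridge to HOL-Algebra ideals is
  \<open>ideal_mpoly_ring_iff\<close>.\<close>

definition sub_ideal :: "'a set \<Rightarrow> bool" where
  "sub_ideal J \<longleftrightarrow> J \<subseteq> C \<and> 0 \<in> J \<and> (\<forall>a\<in>J. \<forall>b\<in>J. a + b \<in> J) \<and> (\<forall>a\<in>J. \<forall>r\<in>C. r * a \<in> J)"

lemma sub_ideal_zero: "sub_ideal J \<Longrightarrow> 0 \<in> J"
  and sub_ideal_add: "sub_ideal J \<Longrightarrow> a \<in> J \<Longrightarrow> b \<in> J \<Longrightarrow> a + b \<in> J"
  and sub_ideal_mult: "sub_ideal J \<Longrightarrow> a \<in> J \<Longrightarrow> r \<in> C \<Longrightarrow> r * a \<in> J"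
  and sub_ideal_subset: "sub_ideal J \<Longrightarrow> J \<subseteq> C"
  by (auto simp: sub_ideal_def)

lemma sub_ideal_uminus: "sub_ideal J \<Longrightarrow> a \<in> J \<Longrightarrow> - a \<in> J"
  using sub_ideal_mult[of J a "- 1"] by simp

lemma sub_ideal_diff: "sub_ideal J \<Longrightarrow> a \<in> J \<Longrightarrow> b \<in> J \<Longrightarrow> a - b \<in> J"
  using sub_ideal_add[of J a "- b"] sub_ideal_uminus by simp

lemma sub_ideal_sum: "sub_ideal J \<Longrightarrow> (\<And>i. i \<in> A \<Longrightarrow> f i \<in> J) \<Longrightarrow> sum f A \<in> J"
  by (induction A rule: infinite_finite_induct) (auto intro: sub_ideal_zero sub_ideal_add)

end

text \<open>
  A Koszul complex whose cochains are arbitrary rather than alternating functions of the index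
  tuple: the Koszul argument for depth applies unchanged, and no signs of permutations occur.
\<close>

fun cobd :: "(nat \<Rightarrow> 'a::comm_ring_1) \<Rightarrow> (nat list \<Rightarrow> 'a) \<Rightarrow> nat list \<Rightarrow> 'a" where
  "cobd g z [] = 0"
| "cobd g z (l # ls) = g l * z ls - cobd g (\<lambda>t. z (l # t)) ls"

lemma cobd_diff: "cobd g (\<lambda>t. z t - w t) ls = cobd g z ls - cobd g w ls"
  by (induction ls arbitrary: z w) (auto simp: algebra_simps)

lemma cobd_cmult: "cobd g (\<lambda>t. c * z t) ls = c * cobd g z ls"
  by (induction ls arbitrary: z) (auto simp: algebra_simps)

lemma cobd_sum: "cobd g (\<lambda>t. \<Sum>i\<in>A. z i t) ls = (\<Sum>i\<in>A. cobd g (z i) ls)"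
  by (induction ls arbitrary: z) (auto simp: sum_distrib_left sum_subtractf)

text \<open>Expanding the first index twice, the two terms \<open>g l * cobd g z ls\<close> cancel;
  the rest is the claim for the shorter tuple and the cochain
  \<open>\<lambda>t. z (l # t)\<close>.\<close>

lemma cobd_cobd: "cobd g (cobd g z) ls = 0"
proof (induction ls arbitrary: z)
  case (Cons l ls)
  have "cobd g (cobd g z) (l # ls)
      = g l * cobd g z ls - (cobd g (\<lambda>t. g l * z t) ls - cobd g (cobd g (\<lambda>t. z (l # t))) ls)"
    by (simp add: cobd_diff)
  then show ?case
    by (simp add: Cons.IH cobd_cmult)
qed simp

locale koszul = subring_class C for C :: "'a::comm_ring_1 set" +
  fixes g :: "nat \<Rightarrow> 'a"
  assumes g_closed [simp]: "\<And>l. g l \<in> C"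
begin

lemma cobd_closed: "(\<And>ls. z ls \<in> C) \<Longrightarrow> cobd g z ls \<in> C"
  by (induction ls arbitrary: z) auto

lemma cobd_in_ideal:
  assumes "sub_ideal J" "\<And>ls. Suc (length ls) = k \<Longrightarrow> z ls \<in> J" "length ls = k"
  shows "cobd g z ls \<in> J"
  using assms(2,3)
proof (induction ls arbitrary: z k)
  case Nil
  then show ?case using sub_ideal_zero[OF assms(1)] by simp
next
  case (Cons l ls)
  have "cobd g (\<lambda>t. z (l # t)) ls \<in> J"
    by (rule Cons.IH[of "length ls"]) (use Cons.prems in auto)
  moreover have "g l * z ls \<in> J"
    using Cons.prems sub_ideal_mult[OF assms(1)] by auto
  ultimately show ?case using sub_ideal_diff[OF assms(1)] by simp
qed

text \<open>Vanishing of the cohomology with coefficients in \<open>C / J\<close> in degree \<open>i\<close>.\<close>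

definition acyclic_at :: "'a set \<Rightarrow> nat \<Rightarrow> bool" where
  "acyclic_at J i \<longleftrightarrow>
     (\<forall>z. (\<forall>ls. z ls \<in> C) \<longrightarrow> (\<forall>ls. length ls = Suc i \<longrightarrow> cobd g z ls \<in> J) \<longrightarrow>
        (\<exists>w. (\<forall>ls. w ls \<in> C) \<and> (\<forall>ls. length ls = i \<longrightarrow> z ls - cobd g w ls \<in> J)))"

lemma acyclic_atD:
  assumes "acyclic_at J i" "\<And>ls. z ls \<in> C" "\<And>ls. length ls = Suc i \<Longrightarrow> cobd g z ls \<in> J"
  shows "\<exists>w. (\<forall>ls. w ls \<in> C) \<and> (\<forall>ls. length ls = i \<longrightarrow> z ls - cobd g w ls \<in> J)"
  using assms unfolding acyclic_at_def by simp

lemma cochain_quotient: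
  assumes "\<And>ls. length ls = k \<Longrightarrow> \<exists>h\<in>C. z ls - y * h \<in> J"
  shows "\<exists>u. (\<forall>ls. u ls \<in> C) \<and> (\<forall>ls. length ls = k \<longrightarrow> z ls - y * u ls \<in> J)"
proof -
  have "\<forall>ls. \<exists>h. h \<in> C \<and> (length ls = k \<longrightarrow> z ls - y * h \<in> J)"
    using assms zero_closed by metis
  then show ?thesis by metis
qed

text \<open>
  The contraction \<open>w\<close> of \<open>z\<close> is a homotopy for multiplication by \<open>y\<close>, so \<open>y z\<close> is the coboundary
  of \<open>w\<close>; now divide by \<open>y\<close>.
\<close>

lemma acyclic_regular_sequence:
  fixes J :: "nat \<Rightarrow> 'a set" and y :: "nat \<Rightarrow> 'a"
  assumes J: "\<And>j. j \<le> m \<Longrightarrow> sub_ideal (J j)"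
    and split: "\<And>j f. j < m \<Longrightarrow> f \<in> J (Suc j) \<Longrightarrow> \<exists>h\<in>C. f - y j * h \<in> J j"
    and incl: "\<And>j f h. j < m \<Longrightarrow> f \<in> J j \<Longrightarrow> h \<in> C \<Longrightarrow> f + y j * h \<in> J (Suc j)"
    and nzd: "\<And>j f. j < m \<Longrightarrow> f \<in> C \<Longrightarrow> y j * f \<in> J j \<Longrightarrow> f \<in> J j"
    and y: "\<And>j. j < m \<Longrightarrow> \<exists>a. (\<forall>l\<in>L. a l \<in> C) \<and> y j - (\<Sum>l\<in>L. a l * g l) \<in> J 0"
    and J0: "\<And>j. j \<le> m \<Longrightarrow> J 0 \<subseteq> J j"
    and "i + j < m"
  shows "acyclic_at (J j) i"
  using \<open>i + j < m\<close>
proof (induction i arbitrary: j)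
  case (0 j)
  show ?case
    unfolding acyclic_at_def
  proof (intro allI impI)
    fix z assume z: "\<forall>ls. z ls \<in> C" and dz: "\<forall>ls. length ls = Suc 0 \<longrightarrow> cobd g z ls \<in> J j"
    have Jj: "sub_ideal (J j)" using J 0 by simp
    obtain a where a: "\<forall>l\<in>L. a l \<in> C" "y j - (\<Sum>l\<in>L. a l * g l) \<in> J j"
      using y[of j] J0[of j] 0 by auto
    \<comment> \<open>A cocycle of degree zero is killed by every \<open>g l\<close>, hence by their
      combination \<open>y j\<close>. Since coboundaries vanish at \<open>[]\<close>, exactness
      means \<open>z [] \<in> J j\<close>.\<close>
    have "g l * z [] \<in> J j" for l
      using dz[rule_format, of "[l]"] by simp
    then have "(\<Sum>l\<in>L. a l * (g l * z [])) \<in> J j"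
      using a(1) sub_ideal_mult[OF Jj] by (intro sub_ideal_sum[OF Jj]) blast
    then have "z [] * (y j - (\<Sum>l\<in>L. a l * g l)) + (\<Sum>l\<in>L. a l * (g l * z [])) \<in> J j"
      using a(2) z sub_ideal_mult[OF Jj] by (intro sub_ideal_add[OF Jj]) auto
    also have "z [] * (y j - (\<Sum>l\<in>L. a l * g l)) + (\<Sum>l\<in>L. a l * (g l * z [])) = y j * z []"
      by (simp add: algebra_simps sum_distrib_left)
    finally have "z [] \<in> J j" using nzd 0 z by simp
    then show "\<exists>w. (\<forall>ls. w ls \<in> C) \<and> (\<forall>ls. length ls = 0 \<longrightarrow> z ls - cobd g w ls \<in> J j)"
      by (intro exI[of _ "\<lambda>_. 0"]) simp
  qed
next
  case (Suc i j)
  show ?case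
    unfolding acyclic_at_def
  proof (intro allI impI)
    fix z assume z: "\<forall>ls. z ls \<in> C"
      and dz: "\<forall>ls. length ls = Suc (Suc i) \<longrightarrow> cobd g z ls \<in> J j"
    have j: "j < m" using Suc by simp
    have Jj: "sub_ideal (J j)" and JSj: "sub_ideal (J (Suc j))" using J j by simp_all
    obtain a where a: "\<forall>l\<in>L. a l \<in> C" "y j - (\<Sum>l\<in>L. a l * g l) \<in> J j"
      using y[of j] J0[of j] j by auto
    define w where "w = (\<lambda>t. \<Sum>l\<in>L. a l * z (l # t))"
    have wC: "w ls \<in> C" for ls unfolding w_def using a z by (intro sum_closed) auto
    have dw: "y j * z ls - cobd g w ls \<in> J j" if "length ls = Suc i" for ls
    proof -
      have "cobd g w ls = (\<Sum>l\<in>L. a l * (g l * z ls - cobd g z (l # ls)))"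
        unfolding w_def by (simp add: cobd_sum cobd_cmult)
      then have "y j * z ls - cobd g w ls
          = z ls * (y j - (\<Sum>l\<in>L. a l * g l)) + (\<Sum>l\<in>L. a l * cobd g z (l # ls))"
        by (simp add: algebra_simps sum_distrib_left sum_subtractf sum.distrib)
      also have "\<dots> \<in> J j"
        using a z dz that sub_ideal_mult[OF Jj]
        by (intro sub_ideal_add[OF Jj] sub_ideal_sum[OF Jj]) (auto simp del: cobd.simps)
      finally show ?thesis .
    qed
    \<comment> \<open>Modulo \<open>J j\<close> the coboundary of \<open>w\<close> is
      \<open>y j * z\<close>, which dies in the next quotient. So \<open>w\<close> is a cocycle
      there, one degree lower, and the sum of degree and index stays below \<open>m\<close>.\<close>
    have "cobd g w ls \<in> J (Suc j)" if "length ls = Suc i" for ls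
      using incl[of j "- (y j * z ls - cobd g w ls)" "z ls"] j z dw[OF that] Jj
        sub_ideal_uminus[of "J j" "y j * z ls - cobd g w ls"] by simp
    moreover have "acyclic_at (J (Suc j)) i" using Suc by simp
    ultimately obtain v where v: "\<And>ls. v ls \<in> C"
        "\<And>ls. length ls = i \<Longrightarrow> w ls - cobd g v ls \<in> J (Suc j)"
      using acyclic_atD[of "J (Suc j)" i w] wC by blast
    obtain u where u: "\<And>ls. u ls \<in> C"
        "\<And>ls. length ls = i \<Longrightarrow> (w ls - cobd g v ls) - y j * u ls \<in> J j"
      using cochain_quotient[of i "\<lambda>ls. w ls - cobd g v ls" "y j" "J j"] split[OF j] v(2) by blast
    \<comment> \<open>The coboundary of \<open>w - cobd g v - y j * u\<close> gives
      \<open>y j * cobd g u = cobd g w = y j * z\<close> modulo \<open>J j\<close>; then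
      \<open>y j\<close> cancels.\<close>
    have "z ls - cobd g u ls \<in> J j" if len: "length ls = Suc i" for ls
    proof -
      have "cobd g (\<lambda>ls. (w ls - cobd g v ls) - y j * u ls) ls \<in> J j"
        by (rule cobd_in_ideal[OF Jj _ len]) (use u in auto)
      then have "cobd g w ls - y j * cobd g u ls \<in> J j"
        by (simp add: cobd_diff cobd_cmult cobd_cobd)
      then have "(y j * z ls - cobd g w ls) + (cobd g w ls - y j * cobd g u ls) \<in> J j"
        using dw[OF len] Jj sub_ideal_add by blast
      then have "y j * (z ls - cobd g u ls) \<in> J j"
        by (simp add: algebra_simps)
      moreover have "z ls - cobd g u ls \<in> C"
        using z cobd_closed u(1) by simp
      ultimately show ?thesis using nzd j by blast
    qed
    then show "\<exists>w. (\<forall>ls. w ls \<in> C) \<and> (\<forall>ls. length ls = Suc i \<longrightarrow> z ls - cobd g w ls \<in> J j)"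
      using u(1) by blast
  qed
qed

text \<open>The long exact cohomology sequence of 0 -> C/J -> C/J -> C/J' -> 0, whose first map is
  multiplication by \<open>y\<close>: degree \<open>i\<close> for \<open>J'\<close> sits between
  degrees \<open>i\<close> and \<open>i + 1\<close> for \<open>J\<close>.\<close>

lemma acyclic_quotient:
  assumes J: "sub_ideal J" "sub_ideal J'"
    and split: "\<And>f. f \<in> J' \<Longrightarrow> \<exists>h\<in>C. f - y * h \<in> J"
    and incl: "J \<subseteq> J'" "y \<in> J'"
    and nzd: "\<And>f. f \<in> C \<Longrightarrow> y * f \<in> J \<Longrightarrow> f \<in> J"
    and acyc: "acyclic_at J i" "acyclic_at J (Suc i)"
  shows "acyclic_at J' i"
  unfolding acyclic_at_def
proof (intro allI impI)
  fix z assume z: "\<forall>ls. z ls \<in> C" and dz: "\<forall>ls. length ls = Suc i \<longrightarrow> cobd g z ls \<in> J'"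
  have yC: "y \<in> C" using incl J(2) sub_ideal_subset by blast
  \<comment> \<open>\<open>u\<close> represents the image of \<open>z\<close> under the connecting
    map.\<close>
  obtain u where u: "\<And>ls. u ls \<in> C" "\<And>ls. length ls = Suc i \<Longrightarrow> cobd g z ls - y * u ls \<in> J"
    using cochain_quotient[of "Suc i" "cobd g z" y J] split dz by blast
  have "cobd g u ls \<in> J" if len: "length ls = Suc (Suc i)" for ls
  proof -
    have "cobd g (\<lambda>ls. cobd g z ls - y * u ls) ls \<in> J"
      by (rule cobd_in_ideal[OF J(1) _ len]) (use u in auto)
    then have "y * cobd g u ls \<in> J"
      using sub_ideal_uminus[OF J(1)] by (fastforce simp: cobd_diff cobd_cmult cobd_cobd)
    then show ?thesis using nzd cobd_closed u(1) by blast
  qed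
  then obtain v where v: "\<And>ls. v ls \<in> C" "\<And>ls. length ls = Suc i \<Longrightarrow> u ls - cobd g v ls \<in> J"
    using acyclic_atD[OF acyc(2), of u] u(1) by blast
  \<comment> \<open>As \<open>u\<close> is the coboundary of \<open>v\<close> modulo
    \<open>J\<close>, subtracting \<open>y * v\<close> lifts \<open>z\<close> to a cocycle modulo
    \<open>J\<close>.\<close>
  have "cobd g (\<lambda>ls. z ls - y * v ls) ls \<in> J" if len: "length ls = Suc i" for ls
  proof -
    have "(cobd g z ls - y * u ls) + y * (u ls - cobd g v ls) \<in> J"
      using u(2)[OF len] sub_ideal_mult[OF J(1) v(2)[OF len] yC] sub_ideal_add[OF J(1)] by blast
    then show ?thesis by (simp add: cobd_diff cobd_cmult algebra_simps)
  qed
  moreover have "z ls - y * v ls \<in> C" for ls using z v(1) yC by simp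
  ultimately obtain t where t: "\<And>ls. t ls \<in> C"
      "\<And>ls. length ls = i \<Longrightarrow> z ls - y * v ls - cobd g t ls \<in> J"
    using acyclic_atD[OF acyc(1), of "\<lambda>ls. z ls - y * v ls"] by blast
  have "z ls - cobd g t ls \<in> J'" if "length ls = i" for ls
  proof -
    have "(z ls - y * v ls - cobd g t ls) + v ls * y \<in> J'"
      using t(2)[OF that] incl sub_ideal_mult[OF J(2) incl(2) v(1)] sub_ideal_add[OF J(2)] by blast
    then show ?thesis by (simp add: algebra_simps)
  qed
  then show "\<exists>w. (\<forall>ls. w ls \<in> C) \<and> (\<forall>ls. length ls = i \<longrightarrow> z ls - cobd g w ls \<in> J')"
    using t(1) by blast
qed

end

section \<open>Substitution in polynomials\<close>

lemma mem_carrier_mpoly_ring: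
  "p \<in> carrier (mpoly_ring n) \<longleftrightarrow> (\<forall>m\<in>Poly_Mapping.keys p. Poly_Mapping.keys m \<subseteq> {1..n})"
  by (simp add: mpoly_ring_def)

lemma poly_mapping_sum_single:
  fixes p :: "'a \<Rightarrow>\<^sub>0 'b::comm_monoid_add"
  shows "p = (\<Sum>m\<in>Poly_Mapping.keys p. Poly_Mapping.single m (Poly_Mapping.lookup p m))"
proof (rule poly_mapping_eqI)
  fix k
  show "Poly_Mapping.lookup p k = Poly_Mapping.lookup (\<Sum>m\<in>Poly_Mapping.keys p. Poly_Mapping.single m (Poly_Mapping.lookup p m)) k"
    by (cases "k \<in> Poly_Mapping.keys p")
      (auto simp: lookup_sum lookup_single when_def not_in_keys_iff_lookup_eq_zero)
qed

lemma poly_mapping_add_induct [case_names single add]: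
  fixes p :: "'a::zero \<Rightarrow>\<^sub>0 'b::comm_monoid_add"
  assumes single: "\<And>m c. m \<in> Poly_Mapping.keys p \<or> c = 0 \<Longrightarrow> P (Poly_Mapping.single m c)"
    and add: "\<And>f g. P f \<Longrightarrow> P g \<Longrightarrow> P (f + g)"
  shows "P p"
proof -
  have "P (\<Sum>m\<in>A. Poly_Mapping.single m (Poly_Mapping.lookup p m))" if "A \<subseteq> Poly_Mapping.keys p" for A
    using finite_subset[OF that finite_keys] that
  proof (induction A rule: finite_induct)
    case empty
    then show ?case using single[of 0 0] by simp
  qed (auto intro: single add)
  from this[OF order_refl] show ?thesis by (simp only: poly_mapping_sum_single[symmetric])
qed

lemma keys_add_nat: "Poly_Mapping.keys (m + m') = Poly_Mapping.keys m \<union> Poly_Mapping.keys m'"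
  for m m' :: "'a \<Rightarrow>\<^sub>0 nat"
  by (auto simp: in_keys_iff lookup_add)

definition monom_ev :: "(nat \<Rightarrow> 'k::field mpolynomial) \<Rightarrow> (nat \<Rightarrow>\<^sub>0 nat) \<Rightarrow> 'k mpolynomial" where
  "monom_ev h m = (\<Prod>i\<in>Poly_Mapping.keys m. h i ^ Poly_Mapping.lookup m i)"

text \<open>The k-algebra endomorphism with x_i going to \<open>h i\<close>. Evaluation at a point
  is the case of constant \<open>h i\<close>, so it needs no second target type.\<close>

definition subst :: "(nat \<Rightarrow> 'k::field mpolynomial) \<Rightarrow> 'k mpolynomial \<Rightarrow> 'k mpolynomial" where
  "subst h p = (\<Sum>m\<in>Poly_Mapping.keys p. Poly_Mapping.single 0 (Poly_Mapping.lookup p m) * monom_ev h m)"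

lemma monom_ev_superset:
  assumes "finite A" "Poly_Mapping.keys m \<subseteq> A"
  shows "monom_ev h m = (\<Prod>i\<in>A. h i ^ Poly_Mapping.lookup m i)"
  unfolding monom_ev_def using assms
  by (intro prod.mono_neutral_left) (auto simp: in_keys_iff)

lemma monom_ev_zero [simp]: "monom_ev h 0 = 1"
  by (simp add: monom_ev_def)

lemma monom_ev_add: "monom_ev h (m + m') = monom_ev h m * monom_ev h m'"
  by (simp add: monom_ev_superset[of "Poly_Mapping.keys m \<union> Poly_Mapping.keys m'"] keys_add_nat
      lookup_add power_add prod.distrib)

lemma subst_single: "subst h (Poly_Mapping.single m c) = Poly_Mapping.single 0 c * monom_ev h m"
  by (cases "c = 0") (auto simp: subst_def)

lemma subst_add: "subst h (p + q) = subst h p + subst h q"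
  unfolding subst_def
  by (rule setsum_keys_plus_distrib) (simp_all add: single_add algebra_simps)

lemma subst_zero [simp]: "subst h 0 = 0"
  by (simp add: subst_def)

lemma subst_one [simp]: "subst h 1 = 1"
  using subst_single[of h 0 1] by simp

lemma subst_const [simp]: "subst h (Poly_Mapping.single 0 c) = Poly_Mapping.single 0 c"
  by (simp add: subst_single)

lemma subst_var [simp]: "subst h (mpoly_var i) = h i"
  by (simp add: subst_single mpoly_var_def monom_ev_def)

lemma subst_uminus: "subst h (- p) = - subst h p"
  using subst_add[of h p "- p"] by (simp add: eq_neg_iff_add_eq_0 add.commute)

lemma subst_diff: "subst h (p - q) = subst h p - subst h q"
  using subst_add[of h p "- q"] by (simp add: subst_uminus)

lemma subst_mult: "subst h (p * q) = subst h p * subst h q"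
proof (induction p rule: poly_mapping_add_induct)
  case (single m c)
  show ?case
  proof (induction q rule: poly_mapping_add_induct)
    case (single m' c')
    have "subst h (Poly_Mapping.single m c * Poly_Mapping.single m' c')
        = (Poly_Mapping.single 0 c * Poly_Mapping.single 0 c') * (monom_ev h m * monom_ev h m')"
      by (simp only: mult_single subst_single monom_ev_add add_0)
    then show ?case by (simp add: subst_single mult_ac)
  qed (simp add: subst_add distrib_left)
qed (simp add: subst_add distrib_right)

lemma subst_power: "subst h (p ^ k) = subst h p ^ k"
  by (induction k) (auto simp: subst_mult)

lemma subst_prod: "subst h (\<Prod>i\<in>A. f i) = (\<Prod>i\<in>A. subst h (f i))"
  by (induction A rule: infinite_finite_induct) (auto simp: subst_mult)

lemma subst_subst: "subst k (subst h p) = subst (\<lambda>i. subst k (h i)) p"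
  by (induction p rule: poly_mapping_add_induct)
    (auto simp: subst_add subst_single subst_mult monom_ev_def subst_prod subst_power)

lemma var_power: "mpoly_var i ^ k = Poly_Mapping.single (Poly_Mapping.single i k) 1"
  by (induction k) (auto simp: mpoly_var_def mult_single simp flip: single_add)

lemma prod_var_power:
  "finite A \<Longrightarrow> (\<Prod>i\<in>A. mpoly_var i ^ e i) =
     Poly_Mapping.single (\<Sum>i\<in>A. Poly_Mapping.single i (e i)) 1"
  by (induction A rule: finite_induct) (auto simp: var_power mult_single)

lemma subst_id [simp]: "subst mpoly_var p = p"
proof (induction p rule: poly_mapping_add_induct)
  case (single m c)
  have "monom_ev mpoly_var m = (Poly_Mapping.single m 1 :: 'a mpolynomial)"
    using poly_mapping_sum_single[of m] by (simp add: monom_ev_def prod_var_power)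
  then show ?case by (simp add: subst_single mult_single)
qed (simp add: subst_add)

lemma one_mpoly_carrier: "1 \<in> carrier (mpoly_ring n)"
  by (auto simp: mem_carrier_mpoly_ring)

lemma const_mpoly_carrier: "Poly_Mapping.single 0 c \<in> carrier (mpoly_ring n)"
  by (auto simp: mem_carrier_mpoly_ring)

lemma var_mpoly_carrier: "i \<in> {1..n} \<Longrightarrow> mpoly_var i \<in> carrier (mpoly_ring n)"
  by (auto simp: mem_carrier_mpoly_ring mpoly_var_def)

lemma add_mpoly_carrier:
  "p \<in> carrier (mpoly_ring n) \<Longrightarrow> q \<in> carrier (mpoly_ring n) \<Longrightarrow> p + q \<in> carrier (mpoly_ring n)"
  using keys_add[of p q] unfolding mem_carrier_mpoly_ring by blast

lemma keys_uminus: "Poly_Mapping.keys (- p) = Poly_Mapping.keys p"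
  for p :: "'a \<Rightarrow>\<^sub>0 'b::ab_group_add"
  by (auto simp: in_keys_iff)

lemma diff_mpoly_carrier:
  "p \<in> carrier (mpoly_ring n) \<Longrightarrow> q \<in> carrier (mpoly_ring n) \<Longrightarrow> p - q \<in> carrier (mpoly_ring n)"
  using add_mpoly_carrier[of p n "- q"] by (simp add: mem_carrier_mpoly_ring keys_uminus)

lemma mult_mpoly_carrier:
  "p \<in> carrier (mpoly_ring n) \<Longrightarrow> q \<in> carrier (mpoly_ring n) \<Longrightarrow> p * q \<in> carrier (mpoly_ring n)"
  using keys_mult[of p q] unfolding mem_carrier_mpoly_ring
  by (fastforce simp: keys_add_nat)

text \<open>Constants and variables generate the polynomial ring as a ring. Membership in the
  carrier is part of the invariant \<open>?Q\<close> because the sum and product cases offer it to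
  the user.\<close>

lemma mpoly_carrier_induct [consumes 1, case_names const var add mult]:
  assumes "p \<in> carrier (mpoly_ring n)"
    and const: "\<And>c. P (Poly_Mapping.single 0 c)"
    and var: "\<And>i. i \<in> {1..n} \<Longrightarrow> P (mpoly_var i)"
    and add: "\<And>f g. f \<in> carrier (mpoly_ring n) \<Longrightarrow> g \<in> carrier (mpoly_ring n)
       \<Longrightarrow> P f \<Longrightarrow> P g \<Longrightarrow> P (f + g)"
    and mult: "\<And>f g. f \<in> carrier (mpoly_ring n) \<Longrightarrow> g \<in> carrier (mpoly_ring n)
       \<Longrightarrow> P f \<Longrightarrow> P g \<Longrightarrow> P (f * g)"
  shows "P p"
proof -
  let ?Q = "\<lambda>p. P p \<and> p \<in> carrier (mpoly_ring n)"
  have mult': "?Q f \<Longrightarrow> ?Q g \<Longrightarrow> ?Q (f * g)" and add': "?Q f \<Longrightarrow> ?Q g \<Longrightarrow> ?Q (f + g)" for f g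
    using mult[of f g] add[of f g] mult_mpoly_carrier[of f n g] add_mpoly_carrier[of f n g]
    by simp_all
  have const': "?Q (Poly_Mapping.single 0 c)" for c
    by (simp add: const const_mpoly_carrier)
  have pow: "?Q (mpoly_var i ^ k)" if "i \<in> {1..n}" for i k
  proof (induction k)
    case 0
    show ?case using const'[of 1] by simp
  next
    case (Suc k)
    show ?case
      unfolding power_Suc by (rule mult'[OF _ Suc]) (intro conjI var var_mpoly_carrier that)
  qed
  have prod: "?Q (\<Prod>i\<in>A. mpoly_var i ^ e i)" if "A \<subseteq> {1..n}" for A e
    using finite_subset[OF that finite_atLeastAtMost] that
  proof (induction A rule: finite_induct)
    case empty
    show ?case using const'[of 1] by simp
  next
    case (insert i A)
    have "?Q (mpoly_var i ^ e i * (\<Prod>i\<in>A. mpoly_var i ^ e i))"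
      by (rule mult'[OF pow]) (use insert in auto)
    then show ?case using insert by simp
  qed
  have "?Q p"
  proof (induction p rule: poly_mapping_add_induct)
    case (single m c)
    show ?case
    proof (cases "c = 0")
      case True
      then show ?thesis using const'[of 0] by simp
    next
      case False
      with single have "Poly_Mapping.keys m \<subseteq> {1..n}"
        using assms(1) by (simp add: mem_carrier_mpoly_ring)
      then have "?Q (monom_ev mpoly_var m)" unfolding monom_ev_def by (rule prod)
      then have "?Q (Poly_Mapping.single 0 c * monom_ev mpoly_var m)" by (intro mult' const')
      then show ?thesis using subst_single[of mpoly_var m c] by simp
    qed
  qed (rule add')
  then show ?thesis ..
qed

lemma subst_mpoly_carrier:
  assumes "p \<in> carrier (mpoly_ring n)" "\<And>i. i \<in> {1..n} \<Longrightarrow> h i \<in> carrier (mpoly_ring n)"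
  shows "subst h p \<in> carrier (mpoly_ring n)"
  using assms(1)
  by (induction rule: mpoly_carrier_induct)
    (auto simp: subst_add subst_mult const_mpoly_carrier assms(2) add_mpoly_carrier mult_mpoly_carrier)

lemma lookup_single_mult:
  "Poly_Mapping.lookup (Poly_Mapping.single a c * p) (a + m) = c * Poly_Mapping.lookup p m"
  for a :: "'a::cancel_comm_monoid_add" and c :: "'b::semiring_1"
  by (induction p rule: poly_mapping_add_induct)
    (auto simp: mult_single lookup_single when_def distrib_left lookup_add)

lemma lookup_single_mult_eq_0:
  "\<nexists>m. k = a + m \<Longrightarrow> Poly_Mapping.lookup (Poly_Mapping.single a c * p) k = 0"
  for a :: "'a::monoid_add" and c :: "'b::semiring_1"
  using keys_mult[of "Poly_Mapping.single a c" p]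
  by (auto simp: not_in_keys_iff_lookup_eq_zero[symmetric] split: if_splits)

section \<open>Monomial ideals of links\<close>

lemma subring_class_mpoly: "subring_class (carrier (mpoly_ring n))"
  by unfold_locales (auto intro: one_mpoly_carrier diff_mpoly_carrier mult_mpoly_carrier)

text \<open>The identity and \<open>subst h\<close> agree modulo \<open>J\<close> on generators,
  hence everywhere. It serves both to divide by x_l - 1 and to generate the ideal of a
  point.\<close>

lemma subst_diff_mem:
  assumes "p \<in> carrier (mpoly_ring n)" and J: "subring_class.sub_ideal (carrier (mpoly_ring n)) J"
    and h: "\<And>i. i \<in> {1..n} \<Longrightarrow> h i \<in> carrier (mpoly_ring n)"
      "\<And>i. i \<in> {1..n} \<Longrightarrow> mpoly_var i - h i \<in> J"
  shows "p - subst h p \<in> J"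
  using assms(1)
proof (induction rule: mpoly_carrier_induct)
  interpret subring_class "carrier (mpoly_ring n)" by (rule subring_class_mpoly)
  {
    case (const c)
    then show ?case using sub_ideal_zero[OF J] by simp
  next
    case (var i)
    then show ?case using h by simp
  next
    case (add f g)
    then show ?case using sub_ideal_add[OF J add(3,4)] by (simp add: subst_add algebra_simps)
  next
    case (mult f g)
    have "f * (g - subst h g) + subst h g * (f - subst h f) \<in> J"
      using mult subst_mpoly_carrier[OF mult(2), of h] h(1)
      by (intro sub_ideal_add[OF J] sub_ideal_mult[OF J]) auto
    then show ?case by (simp add: subst_mult algebra_simps)
  }
qed

definition set_vars_one :: "nat set \<Rightarrow> 'k::field mpolynomial \<Rightarrow> 'k mpolynomial" where
  "set_vars_one \<tau> = subst (\<lambda>i. if i \<in> \<tau> then 1 else mpoly_var i)"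

lemma set_vars_one_var: "set_vars_one \<tau> (mpoly_var i) = (if i \<in> \<tau> then 1 else mpoly_var i)"
  by (simp add: set_vars_one_def)

lemma set_vars_one_empty [simp]: "set_vars_one {} p = p"
  using subst_id[of p] by (simp add: set_vars_one_def del: subst_id)

lemma set_vars_one_Un: "set_vars_one \<sigma> (set_vars_one \<tau> p) = set_vars_one (\<sigma> \<union> \<tau>) p"
  unfolding set_vars_one_def subst_subst
  by (rule arg_cong[of _ _ "\<lambda>h. subst h p"]) auto

lemma set_vars_one_carrier:
  "p \<in> carrier (mpoly_ring n) \<Longrightarrow> set_vars_one \<tau> p \<in> carrier (mpoly_ring n)"
  unfolding set_vars_one_def
  by (rule subst_mpoly_carrier) (auto intro: one_mpoly_carrier var_mpoly_carrier)

text \<open>Monomials may merge and cancel when variables become 1, so supports can be traced only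
  backwards: a surviving monomial is some monomial of \<open>p\<close> stripped of its variables in
  \<tau>.\<close>

lemma keys_set_vars_one:
  assumes "m' \<in> Poly_Mapping.keys (set_vars_one \<tau> p)"
  shows "\<exists>m\<in>Poly_Mapping.keys p. Poly_Mapping.keys m \<subseteq> Poly_Mapping.keys m' \<union> \<tau>"
proof -
  let ?h = "\<lambda>i. if i \<in> \<tau> then 1 else mpoly_var i :: 'a mpolynomial"
  obtain m where m: "m \<in> Poly_Mapping.keys p"
      "m' \<in> Poly_Mapping.keys (Poly_Mapping.single 0 (Poly_Mapping.lookup p m) * monom_ev ?h m)"
    using subsetD[OF keys_sum assms[unfolded set_vars_one_def subst_def]] by blast
  define e where "e = (\<Sum>i\<in>Poly_Mapping.keys m - \<tau>.
    Poly_Mapping.single i (Poly_Mapping.lookup m i))"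
  have "monom_ev ?h m = (\<Prod>i\<in>Poly_Mapping.keys m - \<tau>. ?h i ^ Poly_Mapping.lookup m i)"
    unfolding monom_ev_def by (rule prod.mono_neutral_right) auto
  also have "\<dots> = (\<Prod>i\<in>Poly_Mapping.keys m - \<tau>. mpoly_var i ^ Poly_Mapping.lookup m i)"
    by (rule prod.cong) auto
  also have "\<dots> = Poly_Mapping.single e 1"
    unfolding e_def by (rule prod_var_power) simp
  finally have "m' = e"
    using m(2) by (auto simp: mult_single split: if_splits)
  moreover have "i \<in> Poly_Mapping.keys e" if "i \<in> Poly_Mapping.keys m" "i \<notin> \<tau>" for i
  proof -
    have "Poly_Mapping.lookup e i = Poly_Mapping.lookup m i"
      unfolding e_def lookup_sum using that by (simp add: lookup_single when_def)
    then show ?thesis using that(1) by (simp add: in_keys_iff)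
  qed
  ultimately show ?thesis using m(1) by blast
qed

text \<open>The Stanley-Reisner ideal of the star of \<tau>, taken in all variables;
  \<open>link_ideal\<close> adds the restriction to the carrier.\<close>

definition nonface_ideal :: "nat set set \<Rightarrow> nat set \<Rightarrow> 'k::field mpolynomial set" where
  "nonface_ideal \<Delta> \<tau> = {p. \<forall>m\<in>Poly_Mapping.keys p. Poly_Mapping.keys m \<union> \<tau> \<notin> \<Delta>}"

lemma nonface_ideal_zero [simp]: "0 \<in> nonface_ideal \<Delta> \<tau>"
  by (simp add: nonface_ideal_def)

lemma nonface_ideal_add:
  "p \<in> nonface_ideal \<Delta> \<tau> \<Longrightarrow> q \<in> nonface_ideal \<Delta> \<tau> \<Longrightarrow> p + q \<in> nonface_ideal \<Delta> \<tau>"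
  using keys_add[of p q] unfolding nonface_ideal_def by blast

lemma nonface_ideal_mult:
  assumes "\<And>F G. F \<in> \<Delta> \<Longrightarrow> G \<subseteq> F \<Longrightarrow> G \<in> \<Delta>" "q \<in> nonface_ideal \<Delta> \<tau>"
  shows "p * q \<in> nonface_ideal \<Delta> \<tau>"
  unfolding nonface_ideal_def
proof (intro CollectI ballI)
  fix m assume "m \<in> Poly_Mapping.keys (p * q)"
  then obtain a b where "m = a + b" "b \<in> Poly_Mapping.keys q"
    using subsetD[OF keys_mult] by blast
  then have "Poly_Mapping.keys b \<union> \<tau> \<subseteq> Poly_Mapping.keys m \<union> \<tau>" "Poly_Mapping.keys b \<union> \<tau> \<notin> \<Delta>"
    using assms(2) by (auto simp: keys_add_nat nonface_ideal_def)
  then show "Poly_Mapping.keys m \<union> \<tau> \<notin> \<Delta>" using assms(1) by blast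
qed

lemma nonface_ideal_lookup:
  "p \<in> nonface_ideal \<Delta> \<tau> \<Longrightarrow> Poly_Mapping.keys m \<union> \<tau> \<in> \<Delta> \<Longrightarrow> Poly_Mapping.lookup p m = 0"
  by (auto simp: nonface_ideal_def in_keys_iff)

text \<open>Look at a face monomial of \<open>p\<close> of least degree in \<open>x\<^sub>l\<close>: it survives in \<open>(x\<^sub>l - 1) p\<close>.\<close>

lemma nonface_ideal_nzd:
  assumes cl: "\<And>F G. F \<in> \<Delta> \<Longrightarrow> G \<subseteq> F \<Longrightarrow> G \<in> \<Delta>"
    and p: "(mpoly_var l - 1) * p \<in> nonface_ideal \<Delta> \<tau>"
  shows "p \<in> nonface_ideal \<Delta> \<tau>"
proof (rule ccontr)
  assume "p \<notin> nonface_ideal \<Delta> \<tau>"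
  then obtain m0 where "m0 \<in> Poly_Mapping.keys p \<and> Poly_Mapping.keys m0 \<union> \<tau> \<in> \<Delta>"
    unfolding nonface_ideal_def by blast
  then obtain m where m: "m \<in> Poly_Mapping.keys p" "Poly_Mapping.keys m \<union> \<tau> \<in> \<Delta>"
    and min: "\<And>m'. m' \<in> Poly_Mapping.keys p \<and> Poly_Mapping.keys m' \<union> \<tau> \<in> \<Delta> \<Longrightarrow>
      Poly_Mapping.lookup m l \<le> Poly_Mapping.lookup m' l"
    using arg_min_nat_lemma[of "\<lambda>m. m \<in> Poly_Mapping.keys p \<and> Poly_Mapping.keys m \<union> \<tau> \<in> \<Delta>" m0
        "\<lambda>m. Poly_Mapping.lookup m l"] by blast
  \<comment> \<open>A contribution to \<open>m\<close> would come from \<open>m\<close> divided by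
    x_l, a face monomial of \<open>p\<close> with a smaller exponent of x_l.\<close>
  have "Poly_Mapping.lookup (mpoly_var l * p) m = 0"
  proof (cases "\<exists>m'. m = Poly_Mapping.single l 1 + m'")
    case True
    then obtain m' where m': "m = Poly_Mapping.single l 1 + m'" by blast
    have "Poly_Mapping.lookup p m' = 0"
    proof (rule ccontr)
      assume "Poly_Mapping.lookup p m' \<noteq> 0"
      moreover have "Poly_Mapping.keys m' \<union> \<tau> \<in> \<Delta>"
        using cl[OF m(2)] m' by (auto simp: keys_add_nat)
      ultimately have "Poly_Mapping.lookup m l \<le> Poly_Mapping.lookup m' l"
        using min by (simp add: in_keys_iff)
      then show False using m' by (simp add: lookup_add)
    qed
    then show ?thesis using m' by (simp add: mpoly_var_def lookup_single_mult)
  next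
    case False
    then show ?thesis unfolding mpoly_var_def by (rule lookup_single_mult_eq_0)
  qed
  then have "Poly_Mapping.lookup ((mpoly_var l - 1) * p) m = - Poly_Mapping.lookup p m"
    by (simp add: algebra_simps lookup_minus)
  then show False
    using nonface_ideal_lookup[OF p m(2)] m(1) by (simp add: in_keys_iff)
qed

text \<open>
  Modulo this ideal, the variables in \<open>\<tau>\<close> are set to one, which turns \<open>k[\<Delta>]\<close> into the
  Stanley-Reisner ring of the link of \<open>\<tau>\<close>.
\<close>

definition link_ideal :: "nat \<Rightarrow> nat set set \<Rightarrow> nat set \<Rightarrow> 'k::field mpolynomial set" where
  "link_ideal n \<Delta> \<tau> = {p \<in> carrier (mpoly_ring n). set_vars_one \<tau> p \<in> nonface_ideal \<Delta> \<tau>}"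

context
  fixes n :: nat and \<Delta> :: "nat set set"
  assumes complex: "simplicial_complex n \<Delta>"
begin

lemma face_subset: "F \<in> \<Delta> \<Longrightarrow> G \<subseteq> F \<Longrightarrow> G \<in> \<Delta>"
  using complex unfolding simplicial_complex_def by blast

interpretation S: subring_class "carrier (mpoly_ring n)"
  by (rule subring_class_mpoly)

lemma sub_ideal_link_ideal: "S.sub_ideal (link_ideal n \<Delta> \<tau> :: 'k::field mpolynomial set)"
  unfolding S.sub_ideal_def link_ideal_def
  by (auto simp: set_vars_one_def subst_add subst_mult
      intro: nonface_ideal_add nonface_ideal_mult[OF face_subset])

text \<open>Adding \<open>l\<close> to \<tau> adds exactly the generator x_l - 1 to the link ideal,
  and this is a nonzerodivisor by \<open>nonface_ideal_nzd\<close>; so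
  \<open>acyclic_quotient\<close> applies.\<close>

lemma acyclic_link_ideal_insert:
  fixes g :: "nat \<Rightarrow> 'k::field mpolynomial"
  assumes g: "\<And>l. g l \<in> carrier (mpoly_ring n)" and l: "l \<in> {1..n}" "l \<notin> \<tau>"
    and acyc: "koszul.acyclic_at (carrier (mpoly_ring n)) g (link_ideal n \<Delta> \<tau>) i"
      "koszul.acyclic_at (carrier (mpoly_ring n)) g (link_ideal n \<Delta> \<tau>) (Suc i)"
  shows "koszul.acyclic_at (carrier (mpoly_ring n)) g (link_ideal n \<Delta> (insert l \<tau>)) i"
proof -
  interpret koszul "carrier (mpoly_ring n)" g
    by unfold_locales (rule g)
  let ?J = "link_ideal n \<Delta> \<tau> :: 'k mpolynomial set"
  let ?J' = "link_ideal n \<Delta> (insert l \<tau>) :: 'k mpolynomial set"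
  let ?y = "mpoly_var l - 1 :: 'k mpolynomial"
  have insert: "set_vars_one (insert l \<tau>) p = set_vars_one {l} (set_vars_one \<tau> p)"
    for p :: "'k mpolynomial"
    by (simp add: set_vars_one_Un)
  have y: "?y \<in> carrier (mpoly_ring n)"
    using l by (simp add: var_mpoly_carrier)
  show ?thesis
  proof (rule acyclic_quotient[where J = ?J and y = ?y, OF _ _ _ _ _ _ acyc])
    show "S.sub_ideal ?J" "S.sub_ideal ?J'" by (rule sub_ideal_link_ideal)+
    show "?J \<subseteq> ?J'"
    proof
      fix p assume p: "p \<in> ?J"
      have "Poly_Mapping.keys m' \<union> insert l \<tau> \<notin> \<Delta>"
        if m': "m' \<in> Poly_Mapping.keys (set_vars_one {l} (set_vars_one \<tau> p))" for m'
      proof -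
        obtain m where m: "m \<in> Poly_Mapping.keys (set_vars_one \<tau> p)"
            "Poly_Mapping.keys m \<subseteq> Poly_Mapping.keys m' \<union> {l}"
          using keys_set_vars_one[OF m'] by blast
        then have "Poly_Mapping.keys m \<union> \<tau> \<notin> \<Delta>"
          using p by (auto simp: link_ideal_def nonface_ideal_def)
        moreover have "Poly_Mapping.keys m \<union> \<tau> \<subseteq> Poly_Mapping.keys m' \<union> insert l \<tau>"
          using m(2) by blast
        ultimately show ?thesis using face_subset by blast
      qed
      then show "p \<in> ?J'"
        using p by (simp add: link_ideal_def nonface_ideal_def insert)
    qed
    show "?y \<in> ?J'"
      using y by (simp add: link_ideal_def set_vars_one_def subst_diff)
    show "f \<in> ?J" if "f \<in> carrier (mpoly_ring n)" "?y * f \<in> ?J" for f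
    proof -
      have "set_vars_one \<tau> (?y * f) = ?y * set_vars_one \<tau> f"
        using l by (simp add: set_vars_one_def subst_mult subst_diff)
      then have "?y * set_vars_one \<tau> f \<in> nonface_ideal \<Delta> \<tau>"
        using that by (simp add: link_ideal_def)
      then show ?thesis
        using nonface_ideal_nzd[OF face_subset] that by (simp add: link_ideal_def)
    qed
    show "\<exists>h\<in>carrier (mpoly_ring n). f - ?y * h \<in> ?J" if f: "f \<in> ?J'" for f
    proof -
      let ?f' = "set_vars_one {l} f"
      have fC: "f \<in> carrier (mpoly_ring n)" using f by (simp add: link_ideal_def)
      have f'C: "?f' \<in> carrier (mpoly_ring n)" by (rule set_vars_one_carrier[OF fC])
      have "f - ?f' \<in> {?y * h |h. h \<in> carrier (mpoly_ring n)}"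
        unfolding set_vars_one_def
      proof (rule subst_diff_mem[OF fC])
        show "S.sub_ideal {?y * h |h. h \<in> carrier (mpoly_ring n)}"
          unfolding S.sub_ideal_def
        proof (intro conjI ballI)
          show "{?y * h |h. h \<in> carrier (mpoly_ring n)} \<subseteq> carrier (mpoly_ring n)"
            using y by auto
          show "0 \<in> {?y * h |h. h \<in> carrier (mpoly_ring n)}"
            by (auto intro: exI[of _ 0])
          show "a + b \<in> {?y * h |h. h \<in> carrier (mpoly_ring n)}"
            if "a \<in> {?y * h |h. h \<in> carrier (mpoly_ring n)}"
              "b \<in> {?y * h |h. h \<in> carrier (mpoly_ring n)}" for a b
            using that by (auto simp flip: distrib_left)
          show "r * a \<in> {?y * h |h. h \<in> carrier (mpoly_ring n)}"
            if "a \<in> {?y * h |h. h \<in> carrier (mpoly_ring n)}" "r \<in> carrier (mpoly_ring n)" for a r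
            using that by (auto simp: mult.left_commute[of r])
        qed
        show "mpoly_var i - (if i \<in> {l} then 1 else mpoly_var i)
            \<in> {?y * h |h. h \<in> carrier (mpoly_ring n)}" for i
          by (cases "i = l") (auto intro: exI[of _ 1] exI[of _ 0])
      qed (auto intro: var_mpoly_carrier)
      then obtain h where h: "h \<in> carrier (mpoly_ring n)" "f - ?f' = ?y * h" by blast
      \<comment> \<open>\<open>?f'\<close> itself need not lie in \<open>?J\<close>, since its
        supports may become nonfaces only together with \<open>l\<close>. The factor x_l supplies
        this vertex, and writing \<open>?f'\<close> as \<open>mpoly_var l * ?f' - ?y * ?f'\<close>
        makes \<open>h - ?f'\<close> the quotient.\<close>
      have "set_vars_one \<tau> (mpoly_var l * ?f') = mpoly_var l * set_vars_one (insert l \<tau>) f"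
        using l set_vars_one_Un[of \<tau> "{l}" f]
        by (simp add: set_vars_one_def subst_mult)
      moreover have "mpoly_var l * set_vars_one (insert l \<tau>) f \<in> nonface_ideal \<Delta> \<tau>"
        unfolding nonface_ideal_def
      proof (intro CollectI ballI)
        fix m assume "m \<in> Poly_Mapping.keys (mpoly_var l * set_vars_one (insert l \<tau>) f)"
        then obtain b where b: "m = Poly_Mapping.single l 1 + b"
            "b \<in> Poly_Mapping.keys (set_vars_one (insert l \<tau>) f)"
          using keys_mult[of "mpoly_var l" "set_vars_one (insert l \<tau>) f"]
          by (auto simp: mpoly_var_def)
        then show "Poly_Mapping.keys m \<union> \<tau> \<notin> \<Delta>"
          using f by (auto simp: link_ideal_def nonface_ideal_def keys_add_nat)
      qed
      ultimately have "mpoly_var l * ?f' \<in> ?J"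
        using l f'C by (simp add: link_ideal_def var_mpoly_carrier)
      moreover have "f - ?y * (h - ?f') = mpoly_var l * ?f'"
        using h(2) by (simp add: algebra_simps)
      ultimately show ?thesis
        using h(1) f'C by (intro bexI[of _ "h - ?f'"]) auto
    qed
  qed
qed

end

text \<open>Generators of the maximal ideal of the indicator point of \<sigma>. The value 0 outside
  \<open>{1..n}\<close> is there because cochains are indexed by tuples of arbitrary
  naturals.\<close>

definition point_gens :: "nat \<Rightarrow> nat set \<Rightarrow> nat \<Rightarrow> 'k::field mpolynomial" where
  "point_gens n \<sigma> l = (if l \<in> {1..n} then mpoly_var l - (if l \<in> \<sigma> then 1 else 0) else 0)"

lemma zero_mpoly_carrier: "0 \<in> carrier (mpoly_ring n)"
  by (simp add: mem_carrier_mpoly_ring)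

lemma point_gens_carrier: "point_gens n \<sigma> l \<in> carrier (mpoly_ring n)"
  by (auto simp: point_gens_def one_mpoly_carrier zero_mpoly_carrier
      intro!: diff_mpoly_carrier var_mpoly_carrier)

lemma koszul_point_gens: "koszul (carrier (mpoly_ring n)) (point_gens n \<sigma>)"
  by (intro koszul.intro subring_class_mpoly koszul_axioms.intro point_gens_carrier)

text \<open>Each vertex of \<sigma> shortens the range of vanishing degrees by one.\<close>

lemma acyclic_link_ideal:
  fixes g :: "nat \<Rightarrow> 'k::field mpolynomial"
  assumes "simplicial_complex n \<Delta>" and g: "\<And>l. g l \<in> carrier (mpoly_ring n)" and "\<sigma> \<subseteq> {1..n}"
    and acyc: "\<And>i. i < d \<Longrightarrow> koszul.acyclic_at (carrier (mpoly_ring n)) g (link_ideal n \<Delta> {}) i"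
    and "i + card \<sigma> < d"
  shows "koszul.acyclic_at (carrier (mpoly_ring n)) g (link_ideal n \<Delta> \<sigma>) i"
  using finite_subset[OF \<open>\<sigma> \<subseteq> {1..n}\<close> finite_atLeastAtMost] \<open>\<sigma> \<subseteq> {1..n}\<close> \<open>i + card \<sigma> < d\<close>
proof (induction \<sigma> arbitrary: i rule: finite_induct)
  case empty
  then show ?case using acyc by simp
next
  case (insert l \<sigma>)
  show ?case
    by (rule acyclic_link_ideal_insert[OF assms(1) g]) (use insert in auto)
qed

text \<open>
  The variables of one part of a disconnected link, completed by zero, form a cocycle of degree one
  that is not a coboundary.
\<close>

lemma disconnected_link_not_acyclic:
  fixes n :: nat and \<Delta> :: "nat set set"
  assumes "simplicial_complex n \<Delta>"
    and A: "A \<subseteq> {1..n}" "A \<inter> \<sigma> = {}"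
    and a: "a \<in> A" "insert a \<sigma> \<in> \<Delta>"
    and b: "b \<in> {1..n}" "b \<notin> A" "b \<notin> \<sigma>" "insert b \<sigma> \<in> \<Delta>"
    and disc: "\<And>i j. i \<in> A \<Longrightarrow> j \<in> {1..n} \<Longrightarrow> j \<notin> A \<Longrightarrow> j \<notin> \<sigma> \<Longrightarrow> insert i (insert j \<sigma>) \<notin> \<Delta>"
  shows "\<not> koszul.acyclic_at (carrier (mpoly_ring n))
    (point_gens n \<sigma> :: nat \<Rightarrow> 'k::field mpolynomial) (link_ideal n \<Delta> \<sigma>) 1"
proof
  let ?g = "point_gens n \<sigma> :: nat \<Rightarrow> 'k mpolynomial"
  let ?J = "link_ideal n \<Delta> \<sigma> :: 'k mpolynomial set"
  interpret koszul "carrier (mpoly_ring n)" ?g by (rule koszul_point_gens)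
  have J: "sub_ideal ?J" by (rule sub_ideal_link_ideal[OF assms(1)])
  assume acyc: "acyclic_at ?J 1"
  define z :: "nat list \<Rightarrow> 'k mpolynomial" where
    "z = (\<lambda>ls. if length ls = 1 \<and> hd ls \<in> A then mpoly_var (hd ls) else 0)"
  have z1: "z [i] = (if i \<in> A then mpoly_var i else 0)" for i by (simp add: z_def)
  have varC: "mpoly_var i \<in> carrier (mpoly_ring n)" if "i \<in> A" for i
    using subsetD[OF A(1) that] by (rule var_mpoly_carrier)
  have zC: "z ls \<in> carrier (mpoly_ring n)" for ls
    by (simp add: z_def varC zero_mpoly_carrier)
  \<comment> \<open>For a vertex \<open>l\<close> outside \<sigma> the product is a monomial on a
    non-edge of the link. For \<open>l\<close> in \<sigma> the generator x_l - 1 vanishes on the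
    link, and for other \<open>l\<close> it is 0.\<close>
  have cross: "?g l * mpoly_var i \<in> ?J" if "i \<in> A" "l \<notin> A" for i l
  proof -
    have "set_vars_one \<sigma> (?g l * mpoly_var i) \<in> nonface_ideal \<Delta> \<sigma>"
    proof (cases "l \<in> {1..n} \<and> l \<notin> \<sigma>")
      case True
      have "set_vars_one \<sigma> (?g l * mpoly_var i) = mpoly_var l * mpoly_var i"
        using True that A by (auto simp: point_gens_def set_vars_one_def subst_mult)
      also have "\<dots> = (Poly_Mapping.single (Poly_Mapping.single l 1 + Poly_Mapping.single i 1) 1 :: 'k mpolynomial)"
        by (simp add: mpoly_var_def mult_single)
      finally show ?thesis
        using True that disc[of i l] A(2)
        by (auto simp: nonface_ideal_def keys_add_nat insert_commute)
    next
      case False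
      then show ?thesis
        by (auto simp: point_gens_def set_vars_one_def subst_mult subst_diff)
    qed
    moreover have "?g l * mpoly_var i \<in> carrier (mpoly_ring n)"
      using that by (intro mult_mpoly_carrier point_gens_carrier varC)
    ultimately show ?thesis by (simp add: link_ideal_def)
  qed
  have "cobd ?g z ls \<in> ?J" if len: "length ls = Suc 1" for ls
  proof -
    obtain l i where ls: "ls = [l, i]"
      using len by (cases ls; cases "tl ls") auto
    have A_notin: "i \<notin> \<sigma>" if "i \<in> A" for i using A(2) that by blast
    have eq: "cobd ?g z ls = ?g l * z [i] - ?g i * z [l]" by (simp add: ls)
    consider "l \<in> A" "i \<in> A" | "l \<notin> A" "i \<in> A" | "l \<in> A" "i \<notin> A" | "l \<notin> A" "i \<notin> A" by blast
    then show ?thesis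
    proof cases
      case 1
      then have "cobd ?g z ls = 0"
        unfolding eq z1 using A(1) A_notin by (auto simp: point_gens_def mult.commute)
      then show ?thesis using sub_ideal_zero[OF J] by simp
    next
      case 2
      then show ?thesis unfolding eq z1 using cross by simp
    next
      case 3
      then show ?thesis unfolding eq z1 using sub_ideal_uminus[OF J cross] by simp
    next
      case 4
      then show ?thesis unfolding eq z1 using sub_ideal_zero[OF J] by simp
    qed
  qed
  then obtain w where w: "\<And>ls. length ls = 1 \<Longrightarrow> z ls - cobd ?g w ls \<in> ?J"
    using acyclic_atD[OF acyc, of z] zC by blast
  \<comment> \<open>A coboundary of degree one is \<open>[i] \<mapsto> ?g i * w []\<close>. Its
    x_i-coefficient on the link is the constant term of \<open>p\<close> for every \<open>i\<close>,
    but \<open>z\<close> requires 1 at \<open>a\<close> and 0 at \<open>b\<close>.\<close>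
  define p where "p = set_vars_one \<sigma> (w [])"
  have lin: "Poly_Mapping.lookup (mpoly_var i * p) (Poly_Mapping.single i 1) = Poly_Mapping.lookup p 0" for i
    using lookup_single_mult[of "Poly_Mapping.single i (1::nat)" "1::'k" p 0] by (simp add: mpoly_var_def)
  have p: "set_vars_one \<sigma> (z [i]) - mpoly_var i * p \<in> nonface_ideal \<Delta> \<sigma>" if "i \<in> {1..n}" "i \<notin> \<sigma>" for i
    using w[of "[i]"] that
    by (simp add: link_ideal_def point_gens_def p_def set_vars_one_def subst_diff subst_mult)
  have "a \<in> {1..n}" "a \<notin> \<sigma>" using a A by auto
  from nonface_ideal_lookup[OF p[OF this], of "Poly_Mapping.single a 1"]
  have "Poly_Mapping.lookup p 0 = 1"
    using a \<open>a \<notin> \<sigma>\<close> lin[of a]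
    by (simp add: z1 set_vars_one_var lookup_minus) (simp add: mpoly_var_def)
  moreover from nonface_ideal_lookup[OF p[OF b(1,3)], of "Poly_Mapping.single b 1"]
  have "Poly_Mapping.lookup p 0 = 0"
    using b lin[of b] by (simp add: z1 set_vars_one_def lookup_minus)
  ultimately show False by simp
qed

section \<open>Prime ideals of quotient rings\<close>

context cring
begin

lemma coset_mem_image_iff:
  assumes "ideal I R" "ideal K R" "I \<subseteq> K" "a \<in> carrier R"
  shows "I +> a \<in> (+>) I ` K \<longleftrightarrow> a \<in> K"
proof
  assume "I +> a \<in> (+>) I ` K"
  then obtain k where k: "k \<in> K" "I +> a = I +> k" by blast
  interpret I: ideal I R by fact
  interpret K: ideal K R by fact
  have "a \<ominus> k \<in> I"
    using quotient_eq_iff_same_a_r_cos[OF assms(1,4)] k K.a_Hcarr by blast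
  then have "(a \<ominus> k) \<oplus> k \<in> K" using assms(3) k by blast
  moreover have "(a \<ominus> k) \<oplus> k = a" using assms(4) K.a_Hcarr[OF k(1)] by algebra
  ultimately show "a \<in> K" by simp
qed blast

lemma carrier_quot_image: "carrier (R Quot I) = (+>) I ` carrier R"
  by (auto simp: FactRing_def A_RCOSETS_def')

lemma quot_mult:
  "ideal I R \<Longrightarrow> a \<in> carrier R \<Longrightarrow> b \<in> carrier R \<Longrightarrow>
    (I +> a) \<otimes>\<^bsub>R Quot I\<^esub> (I +> b) = I +> a \<otimes> b"
  by (simp add: FactRing_def ideal.rcoset_mult_add)

lemma quot_add:
  "ideal I R \<Longrightarrow> a \<in> carrier R \<Longrightarrow> b \<in> carrier R \<Longrightarrow>
    (I +> a) \<oplus>\<^bsub>R Quot I\<^esub> (I +> b) = I +> (a \<oplus> b)"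
  using ring_hom_add[OF ideal.rcos_ring_hom] by fastforce

lemma image_quot_proper:
  assumes "ideal I R" "ideal K R" "I \<subseteq> K" "carrier R \<noteq> K"
  shows "carrier (R Quot I) \<noteq> (+>) I ` K"
proof
  assume eq: "carrier (R Quot I) = (+>) I ` K"
  have "a \<in> K" if "a \<in> carrier R" for a
    using coset_mem_image_iff[OF assms(1-3) that] that eq carrier_quot_image by blast
  then show False
    using assms(4) additive_subgroup.a_subset[OF ideal.axioms(1)[OF assms(2)]] by blast
qed

lemma primeideal_quot:
  assumes I: "ideal I R" and K: "primeideal K R" and sub: "I \<subseteq> K"
  shows "primeideal ((+>) I ` K) (R Quot I)"
proof (rule primeidealI)
  interpret K: primeideal K R by fact
  have idK: "ideal K R" by (rule K.ideal_axioms)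
  show "ideal ((+>) I ` K) (R Quot I)" by (rule ring_ideal_imp_quot_ideal[OF I idK])
  show "cring (R Quot I)" by (rule ideal.quotient_is_cring[OF I is_cring])
  show "carrier (R Quot I) \<noteq> (+>) I ` K" by (rule image_quot_proper[OF I idK sub K.I_notcarr])
  show "X \<in> (+>) I ` K \<or> Y \<in> (+>) I ` K"
    if XY: "X \<in> carrier (R Quot I)" "Y \<in> carrier (R Quot I)" "X \<otimes>\<^bsub>R Quot I\<^esub> Y \<in> (+>) I ` K" for X Y
  proof -
    obtain a b where ab: "a \<in> carrier R" "b \<in> carrier R" "X = I +> a" "Y = I +> b"
      using XY(1,2) unfolding carrier_quot_image by (elim imageE) simp
    have "a \<otimes> b \<in> K"
      using XY(3) ab coset_mem_image_iff[OF I idK sub, of "a \<otimes> b"] by (simp add: quot_mult[OF I])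
    then show ?thesis using K.I_prime[OF ab(1,2)] ab(3,4) by blast
  qed
qed

lemma maximalideal_quot:
  assumes I: "ideal I R" and K: "maximalideal K R" and sub: "I \<subseteq> K"
  shows "maximalideal ((+>) I ` K) (R Quot I)"
proof (rule maximalidealI)
  interpret K: maximalideal K R by fact
  have idK: "ideal K R" by (rule K.ideal_axioms)
  show "ideal ((+>) I ` K) (R Quot I)" by (rule ring_ideal_imp_quot_ideal[OF I idK])
  show "carrier (R Quot I) \<noteq> (+>) I ` K" by (rule image_quot_proper[OF I idK sub K.I_notcarr])
  show "J = (+>) I ` K \<or> J = carrier (R Quot I)"
    if J: "ideal J (R Quot I)" "(+>) I ` K \<subseteq> J" "J \<subseteq> carrier (R Quot I)" for J
  proof -
    define L where "L = {r \<in> carrier R. I +> r \<in> J}"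
    have "ideal L R"
      unfolding L_def by (rule ring_hom_ring.ideal_vimage[OF ideal.rcos_ring_hom_ring[OF I] J(1)])
    moreover have "K \<subseteq> L" using J(2) K.a_Hcarr by (auto simp: L_def)
    moreover have "L \<subseteq> carrier R" by (auto simp: L_def)
    ultimately have "L = K \<or> L = carrier R" by (intro K.I_maximal)
    moreover have "J = (+>) I ` L" using J(3) unfolding carrier_quot_image L_def by blast
    ultimately show ?thesis by (auto simp: carrier_quot_image)
  qed
qed

text \<open>Gives consecutive ideals of a regular sequence the shape J + yR that
  \<open>split\<close> and \<open>incl\<close> of \<open>acyclic_regular_sequence\<close> ask
  for.\<close>

lemma genideal_insert:
  assumes "A \<subseteq> carrier R" "y \<in> carrier R"
  shows "Idl (insert y A) = {a \<oplus> y \<otimes> r | a r. a \<in> Idl A \<and> r \<in> carrier R}"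
proof -
  have A: "ideal (Idl A) R" and y: "ideal (PIdl y) R"
    using assms genideal_ideal cgenideal_ideal by auto
  have "Idl (insert y A) = Idl (Idl A \<union> PIdl y)"
  proof (rule equalityI)
    show "Idl (insert y A) \<subseteq> Idl (Idl A \<union> PIdl y)"
    proof (rule genideal_minimal)
      have U: "Idl A \<union> PIdl y \<subseteq> carrier R"
        using additive_subgroup.a_subset[OF ideal.axioms(1)[OF A]]
          additive_subgroup.a_subset[OF ideal.axioms(1)[OF y]] by blast
      show "ideal (Idl (Idl A \<union> PIdl y)) R" by (rule genideal_ideal[OF U])
      show "insert y A \<subseteq> Idl (Idl A \<union> PIdl y)"
        using genideal_self[OF U] genideal_self[OF assms(1)] cgenideal_self[OF assms(2)] by blast
    qed
    show "Idl (Idl A \<union> PIdl y) \<subseteq> Idl (insert y A)"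
    proof (rule genideal_minimal)
      have iA: "insert y A \<subseteq> carrier R" using assms by blast
      show id: "ideal (Idl (insert y A)) R" by (rule genideal_ideal[OF iA])
      show "Idl A \<union> PIdl y \<subseteq> Idl (insert y A)"
        using genideal_self[OF iA] genideal_minimal[OF id, of A] cgenideal_minimal[OF id, of y] by blast
    qed
  qed
  also have "\<dots> = Idl A <+> PIdl y" by (rule union_genideal[OF A y])
  also have "\<dots> = {a \<oplus> y \<otimes> r | a r. a \<in> Idl A \<and> r \<in> carrier R}"
    using assms(2) m_comm by (auto simp: set_add_defs cgenideal_def) (metis, metis)
  finally show ?thesis .
qed

end

section \<open>Regular sequences from the Cohen-Macaulay property\<close>

text \<open>An infinite supremum is not attained, hence only \<open>d \<le> m\<close>. Positivity of
  \<open>d\<close> excludes empty \<open>N\<close>, whose supremum is 0.\<close>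

lemma enat_Sup_ge_obtain:
  assumes "enat d \<le> Sup (enat ` N)" "0 < d"
  obtains m where "m \<in> N" "d \<le> m"
proof (rule ccontr)
  assume "\<not> thesis"
  then have "\<And>m. m \<in> N \<Longrightarrow> m \<le> d - 1" using that by fastforce
  then have "Sup (enat ` N) \<le> enat (d - 1)" by (intro Sup_least) auto
  then have "enat d \<le> enat (d - 1)" using assms(1) order_trans by blast
  then show False using assms(2) by simp
qed

text \<open>The chain bounds \<open>prime_codim\<close> from below, and the Cohen-Macaulay equality
  passes the bound on to \<open>ideal_depth\<close>. For \<open>d = 0\<close> the empty sequence is
  regular because \<open>P\<close> is proper.\<close>

lemma regular_sequence_of_chain:
  assumes "cohen_macaulay_ring R" and "maximalideal P R"
    and "\<And>i. i \<le> d \<Longrightarrow> primeideal (Q i) R" "\<And>i. i < d \<Longrightarrow> Q i \<subset> Q (Suc i)" "Q d = P"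
  obtains xs where "regular_sequence R xs" "set xs \<subseteq> P" "d \<le> length xs"
proof (cases "d = 0")
  case True
  have "regular_sequence R []"
  proof -
    interpret maximalideal P R by fact
    have "Idl\<^bsub>R\<^esub> {} \<subseteq> P" by (rule genideal_minimal[OF ideal_axioms]) simp
    then show ?thesis using I_notcarr a_subset by (auto simp: regular_sequence_def)
  qed
  then show ?thesis using that[of "[]"] True by simp
next
  case False
  have "enat d \<le> prime_codim R P"
    unfolding prime_codim_def using assms(3-5) by (intro Sup_upper) blast
  also have "\<dots> = ideal_depth R P"
    using assms(1,2) by (simp add: cohen_macaulay_ring_def)
  also have "\<dots> = Sup (enat ` (length ` {xs. regular_sequence R xs \<and> set xs \<subseteq> P}))"
    unfolding ideal_depth_def by (rule arg_cong[of _ _ Sup]) auto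
  finally obtain m where "m \<in> length ` {xs. regular_sequence R xs \<and> set xs \<subseteq> P}" "d \<le> m"
    using enat_Sup_ge_obtain False by blast
  then show ?thesis using that by blast
qed

section \<open>The Stanley-Reisner ring\<close>

lemma mpoly_ring_simps:
  "x \<otimes>\<^bsub>mpoly_ring n\<^esub> y = x * y" "x \<oplus>\<^bsub>mpoly_ring n\<^esub> y = x + y"
  "\<one>\<^bsub>mpoly_ring n\<^esub> = 1" "\<zero>\<^bsub>mpoly_ring n\<^esub> = 0"
  by (simp_all add: mpoly_ring_def)

lemma uminus_mpoly_carrier: "p \<in> carrier (mpoly_ring n) \<Longrightarrow> - p \<in> carrier (mpoly_ring n)"
  by (simp add: mem_carrier_mpoly_ring keys_uminus)

lemma cring_mpoly: "cring (mpoly_ring n :: 'k::field mpolynomial ring)"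
proof (rule cringI)
  show "abelian_group (mpoly_ring n :: 'k mpolynomial ring)"
  proof (rule abelian_groupI)
    show "\<exists>y\<in>carrier (mpoly_ring n). y \<oplus>\<^bsub>mpoly_ring n\<^esub> x = \<zero>\<^bsub>mpoly_ring n\<^esub>"
      if "x \<in> carrier (mpoly_ring n)" for x :: "'k mpolynomial"
      using that by (intro bexI[of _ "- x"]) (auto simp: mpoly_ring_simps uminus_mpoly_carrier)
  qed (auto simp: mpoly_ring_simps add_mpoly_carrier zero_mpoly_carrier add_ac)
  show "comm_monoid (mpoly_ring n :: 'k mpolynomial ring)"
    by (rule comm_monoidI) (auto simp: mpoly_ring_simps mult_mpoly_carrier one_mpoly_carrier mult_ac)
qed (simp add: mpoly_ring_simps distrib_right)

lemma minus_mpoly_ring: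
  assumes "x \<in> carrier (mpoly_ring n)" "y \<in> carrier (mpoly_ring n)"
  shows "x \<ominus>\<^bsub>mpoly_ring n\<^esub> y = x - y"
proof -
  interpret cring "mpoly_ring n" by (rule cring_mpoly)
  have "\<ominus>\<^bsub>mpoly_ring n\<^esub> y = - y"
    using assms by (intro minus_equality) (auto simp: mpoly_ring_simps uminus_mpoly_carrier)
  then show ?thesis by (simp add: a_minus_def mpoly_ring_simps)
qed

lemma ideal_mpoly_ring_iff:
  "ideal J (mpoly_ring n) \<longleftrightarrow> subring_class.sub_ideal (carrier (mpoly_ring n)) J"
proof -
  interpret R: cring "mpoly_ring n :: 'a mpolynomial ring" by (rule cring_mpoly)
  interpret S: subring_class "carrier (mpoly_ring n) :: 'a mpolynomial set"
    by (rule subring_class_mpoly)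
  show ?thesis
  proof
    assume "ideal J (mpoly_ring n)"
    then interpret ideal J "mpoly_ring n" .
    show "S.sub_ideal J"
      unfolding S.sub_ideal_def
      using a_subset additive_subgroup.zero_closed[OF is_additive_subgroup] a_closed I_l_closed
      by (auto simp: mpoly_ring_simps)
  next
    assume J: "S.sub_ideal J"
    have neg: "\<ominus>\<^bsub>mpoly_ring n\<^esub> a \<in> J" if "a \<in> J" for a
    proof -
      have a: "a \<in> carrier (mpoly_ring n)" using that S.sub_ideal_subset[OF J] by blast
      have "\<ominus>\<^bsub>mpoly_ring n\<^esub> a = - a"
        using a by (intro R.minus_equality) (auto simp: mpoly_ring_simps uminus_mpoly_carrier)
      then show ?thesis using S.sub_ideal_uminus[OF J that] by simp
    qed
    show "ideal J (mpoly_ring n)"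
    proof (rule idealI)
      show "ring (mpoly_ring n :: 'a mpolynomial ring)" by (rule R.ring_axioms)
      show "subgroup J (add_monoid (mpoly_ring n))"
      proof (rule R.add.subgroupI)
        show "J \<subseteq> carrier (mpoly_ring n)" by (rule S.sub_ideal_subset[OF J])
        show "J \<noteq> {}" using S.sub_ideal_zero[OF J] by blast
      qed (use neg S.sub_ideal_add[OF J] in \<open>auto simp: mpoly_ring_simps\<close>)
      show "x \<otimes>\<^bsub>mpoly_ring n\<^esub> a \<in> J" "a \<otimes>\<^bsub>mpoly_ring n\<^esub> x \<in> J"
        if "a \<in> J" "x \<in> carrier (mpoly_ring n)" for a x
        using S.sub_ideal_mult[OF J that] by (simp_all add: mpoly_ring_simps mult.commute[of a])
    qed
  qed
qed

text \<open>A monomial whose support is a nonface is a multiple of the squarefree monomial on that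
  support, which is one of the generators.\<close>

lemma stanley_reisner_ideal_eq:
  assumes "simplicial_complex n \<Delta>"
  shows "stanley_reisner_ideal n \<Delta> = (link_ideal n \<Delta> {} :: 'k::field mpolynomial set)"
proof -
  interpret R: cring "mpoly_ring n :: 'k mpolynomial ring" by (rule cring_mpoly)
  interpret S: subring_class "carrier (mpoly_ring n) :: 'k mpolynomial set"
    by (rule subring_class_mpoly)
  define G :: "'k mpolynomial set"
    where "G = {\<Prod>i\<in>F. mpoly_var i | F. F \<subseteq> {1..n} \<and> F \<notin> \<Delta>}"
  define e :: "nat set \<Rightarrow> nat \<Rightarrow>\<^sub>0 nat" where "e F = (\<Sum>i\<in>F. Poly_Mapping.single i 1)" for F
  have lookup_e: "Poly_Mapping.lookup (e F) i = (if i \<in> F then 1 else 0)" if "finite F" for F i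
    using that by (simp add: e_def lookup_sum lookup_single when_def)
  have keys_e: "Poly_Mapping.keys (e F) = F" if "finite F" for F
    using that by (auto simp: in_keys_iff lookup_e split: if_splits)
  have prod: "(\<Prod>i\<in>F. mpoly_var i) = (Poly_Mapping.single (e F) 1 :: 'k mpolynomial)"
    if "finite F" for F
    using prod_var_power[OF that, of "\<lambda>_. 1"] by (simp add: e_def)
  have fin: "finite F" if "F \<subseteq> {1..n}" for F
    using that finite_subset by blast
  have GC: "G \<subseteq> carrier (mpoly_ring n)"
    using fin by (auto simp: G_def prod mem_carrier_mpoly_ring keys_e)
  have "ideal (link_ideal n \<Delta> {}) (mpoly_ring n :: 'k mpolynomial ring)"
    unfolding ideal_mpoly_ring_iff by (rule sub_ideal_link_ideal[OF assms])
  moreover have "G \<subseteq> link_ideal n \<Delta> {}"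
    using GC fin by (auto simp: link_ideal_def nonface_ideal_def G_def prod keys_e)
  ultimately have "Idl\<^bsub>mpoly_ring n\<^esub> G \<subseteq> link_ideal n \<Delta> {}"
    by (rule R.genideal_minimal)
  moreover have "link_ideal n \<Delta> {} \<subseteq> Idl\<^bsub>mpoly_ring n\<^esub> G"
  proof
    fix p :: "'k mpolynomial" assume p: "p \<in> link_ideal n \<Delta> {}"
    have I: "S.sub_ideal (Idl\<^bsub>mpoly_ring n\<^esub> G)"
      using R.genideal_ideal[OF GC] by (simp add: ideal_mpoly_ring_iff)
    have "Poly_Mapping.single m c \<in> Idl\<^bsub>mpoly_ring n\<^esub> G" if m: "m \<in> Poly_Mapping.keys p" for m c
    proof -
      let ?F = "Poly_Mapping.keys m"
      have F: "?F \<subseteq> {1..n}" "?F \<notin> \<Delta>"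
        using p m by (auto simp: link_ideal_def nonface_ideal_def mem_carrier_mpoly_ring)
      \<comment> \<open>The truncated subtraction is exact: exponents on the support are at least
        1.\<close>
      have "m = (m - e ?F) + e ?F"
        by (rule poly_mapping_eqI)
          (auto simp: lookup_add lookup_minus lookup_e in_keys_iff)
      then have "Poly_Mapping.single m c
          = Poly_Mapping.single (m - e ?F) c * (\<Prod>i\<in>?F. mpoly_var i :: 'k mpolynomial)"
        by (simp add: prod mult_single)
      moreover have "Poly_Mapping.single (m - e ?F) c \<in> carrier (mpoly_ring n)"
        using F(1) by (auto simp: mem_carrier_mpoly_ring in_keys_iff lookup_minus split: if_splits)
      moreover have "(\<Prod>i\<in>?F. mpoly_var i :: 'k mpolynomial) \<in> Idl\<^bsub>mpoly_ring n\<^esub> G"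
        using R.genideal_self[OF GC] F by (auto simp: G_def)
      ultimately show ?thesis using S.sub_ideal_mult[OF I] by simp
    qed
    then have "(\<Sum>m\<in>Poly_Mapping.keys p. Poly_Mapping.single m (Poly_Mapping.lookup p m))
        \<in> Idl\<^bsub>mpoly_ring n\<^esub> G"
      by (intro S.sub_ideal_sum[OF I]) blast
    then show "p \<in> Idl\<^bsub>mpoly_ring n\<^esub> G" using poly_mapping_sum_single[of p] by simp
  qed
  ultimately show ?thesis unfolding stanley_reisner_ideal_def G_def by blast
qed

text \<open>Kernels of maps into a domain, hence prime. Ideals of coordinate subspaces and of points
  are both of this form, as are the ideals between them in \<open>face_prime_chain\<close>.\<close>

definition subst_kernel :: "nat \<Rightarrow> (nat \<Rightarrow> 'k::field mpolynomial) \<Rightarrow> 'k mpolynomial set" where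
  "subst_kernel n h = {p \<in> carrier (mpoly_ring n). subst h p = 0}"

lemma sub_ideal_subst_kernel:
  "subring_class.sub_ideal (carrier (mpoly_ring n)) (subst_kernel n h)"
  unfolding subring_class.sub_ideal_def[OF subring_class_mpoly]
  by (auto simp: subst_kernel_def subst_add subst_mult zero_mpoly_carrier add_mpoly_carrier
      mult_mpoly_carrier)

lemma primeideal_subst_kernel: "primeideal (subst_kernel n h) (mpoly_ring n)"
proof (rule primeidealI)
  show "ideal (subst_kernel n h) (mpoly_ring n)"
    unfolding ideal_mpoly_ring_iff by (rule sub_ideal_subst_kernel)
  show "cring (mpoly_ring n :: 'a mpolynomial ring)" by (rule cring_mpoly)
  have "1 \<in> carrier (mpoly_ring n)" "1 \<notin> subst_kernel n h"
    by (simp_all add: subst_kernel_def one_mpoly_carrier)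
  then show "carrier (mpoly_ring n) \<noteq> subst_kernel n h" by blast
qed (auto simp: subst_kernel_def subst_mult mpoly_ring_simps)

text \<open>Modulo the kernel every polynomial is a constant, so any ideal strictly above it
  contains a nonzero constant.\<close>

lemma maximalideal_subst_kernel:
  fixes h :: "nat \<Rightarrow> 'k::field mpolynomial"
  assumes h: "\<And>i. i \<in> {1..n} \<Longrightarrow> h i = Poly_Mapping.single 0 (c i)"
  shows "maximalideal (subst_kernel n h) (mpoly_ring n)"
proof (rule maximalidealI)
  interpret S: subring_class "carrier (mpoly_ring n) :: 'k mpolynomial set"
    by (rule subring_class_mpoly)
  show "ideal (subst_kernel n h) (mpoly_ring n)"
    unfolding ideal_mpoly_ring_iff by (rule sub_ideal_subst_kernel)
  show "carrier (mpoly_ring n) \<noteq> subst_kernel n h"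
    by (rule primeideal.I_notcarr[OF primeideal_subst_kernel])
  have const: "\<exists>c. subst h p = Poly_Mapping.single 0 c" if "p \<in> carrier (mpoly_ring n)" for p
    using that
  proof (induction rule: mpoly_carrier_induct)
    case (add f g)
    then show ?case by (auto simp: subst_add simp flip: single_add)
  next
    case (mult f g)
    then show ?case by (auto simp: subst_mult mult_single)
  qed (use h in auto)
  show "J = subst_kernel n h \<or> J = carrier (mpoly_ring n)"
    if J: "ideal J (mpoly_ring n)" "subst_kernel n h \<subseteq> J" "J \<subseteq> carrier (mpoly_ring n)" for J
  proof (cases "J = subst_kernel n h")
    case False
    then obtain g where g: "g \<in> J" "g \<notin> subst_kernel n h" using J(2) by blast
    then have gC: "g \<in> carrier (mpoly_ring n)" using J(3) by blast
    obtain a where a: "subst h g = Poly_Mapping.single 0 a" using const[OF gC] by blast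
    have "subst h g \<noteq> 0" using g(2) gC by (simp add: subst_kernel_def)
    then have "a \<noteq> 0" unfolding a by (metis single_zero)
    have J': "S.sub_ideal J" using J(1) by (simp add: ideal_mpoly_ring_iff)
    have "g - Poly_Mapping.single 0 a \<in> subst_kernel n h"
      using gC by (simp add: subst_kernel_def subst_diff a diff_mpoly_carrier const_mpoly_carrier)
    then have "g - Poly_Mapping.single 0 a \<in> J" using J(2) by blast
    then have "g - (g - Poly_Mapping.single 0 a) \<in> J"
      by (rule S.sub_ideal_diff[OF J' g(1)])
    then have "Poly_Mapping.single 0 (inverse a) * Poly_Mapping.single 0 a \<in> J"
      by (intro S.sub_ideal_mult[OF J']) (simp_all add: const_mpoly_carrier)
    then have "\<one>\<^bsub>mpoly_ring n\<^esub> \<in> J"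
      using \<open>a \<noteq> 0\<close> by (simp add: mult_single mpoly_ring_simps)
    then show ?thesis using ideal.one_imp_carrier[OF J(1)] by blast
  qed blast
qed

text \<open>Carries a regular sequence of the quotient ring over to
  \<open>acyclic_regular_sequence\<close>: \<open>J j\<close> is the preimage in the polynomial ring
  of the ideal of the first \<open>j\<close> elements.\<close>

lemma acyclic_of_regular_sequence:
  fixes g :: "nat \<Rightarrow> 'k::field mpolynomial"
  assumes I: "ideal I (mpoly_ring n)" and g: "\<And>l. g l \<in> carrier (mpoly_ring n)"
    and reg: "regular_sequence (mpoly_ring n Quot I) xs"
    and K: "K \<subseteq> carrier (mpoly_ring n)" "set xs \<subseteq> (+>\<^bsub>mpoly_ring n\<^esub>) I ` K"
    and gens: "\<And>f. f \<in> K \<Longrightarrow> \<exists>a. (\<forall>l\<in>L. a l \<in> carrier (mpoly_ring n)) \<and> f - (\<Sum>l\<in>L. a l * g l) \<in> I"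
    and "i < length xs"
  shows "koszul.acyclic_at (carrier (mpoly_ring n)) g I i"
proof -
  interpret koszul "carrier (mpoly_ring n)" g
    by (intro koszul.intro subring_class_mpoly koszul_axioms.intro g)
  let ?R = "mpoly_ring n :: 'k mpolynomial ring"
  let ?Q = "?R Quot I"
  let ?c = "\<lambda>f. I +>\<^bsub>?R\<^esub> f"
  have cR: "cring ?R" by (rule cring_mpoly)
  have rR: "ring ?R" using cR by (rule cring.axioms)
  have cQ: "cring ?Q" by (rule ideal.quotient_is_cring[OF I cR])
  have rQ: "ring ?Q" using cQ by (rule cring.axioms)
  have hom: "ring_hom_ring ?R ?Q ?c" by (rule ideal.rcos_ring_hom_ring[OF I])
  have coset_eq: "?c f = ?c f' \<longleftrightarrow> f - f' \<in> I" if "f \<in> carrier ?R" "f' \<in> carrier ?R" for f f'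
    using ring.quotient_eq_iff_same_a_r_cos[OF rR I that] minus_mpoly_ring[OF that] by simp
  have coset_zero: "?c f = \<zero>\<^bsub>?Q\<^esub> \<longleftrightarrow> f \<in> I" if "f \<in> carrier ?R" for f
  proof -
    have "?c 0 = \<zero>\<^bsub>?Q\<^esub>"
      using ring_hom_zero[OF ring_hom_ring.homh[OF hom] rR rQ] by (simp add: mpoly_ring_simps)
    then show ?thesis using coset_eq[OF that zero_mpoly_carrier] by simp
  qed
  have xsQ: "set xs \<subseteq> carrier ?Q" using reg by (simp add: regular_sequence_def)
  then have takeQ: "set (take j xs) \<subseteq> carrier ?Q" for j using set_take_subset[of j xs] by blast
  \<comment> \<open>The lifts are chosen in \<open>K\<close>, so that \<open>gens\<close> writes
    each of them as a combination of the \<open>g l\<close> modulo \<open>I\<close>.\<close>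
  have "\<exists>y. y \<in> K \<and> xs ! j = ?c y" if "j < length xs" for j
    using K(2) nth_mem[OF that] by blast
  then obtain y where y: "\<And>j. j < length xs \<Longrightarrow> y j \<in> K \<and> xs ! j = ?c (y j)" by metis
  then have yC: "y j \<in> carrier ?R" if "j < length xs" for j using K(1) that by blast
  define J where "J j = {f \<in> carrier ?R. ?c f \<in> Idl\<^bsub>?Q\<^esub> (set (take j xs))}" for j
  have idl: "ideal (Idl\<^bsub>?Q\<^esub> (set (take j xs))) ?Q" for j
    by (rule ring.genideal_ideal[OF rQ takeQ])
  have Jid: "sub_ideal (J j)" for j
    unfolding J_def ideal_mpoly_ring_iff[symmetric]
    by (rule ring_hom_ring.ideal_vimage[OF hom idl])
  have IJ: "I \<subseteq> J j" for j
  proof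
    fix f assume "f \<in> I"
    then have f: "f \<in> carrier ?R" "?c f = \<zero>\<^bsub>?Q\<^esub>"
      using coset_zero additive_subgroup.a_subset[OF ideal.axioms(1)[OF I]] by blast+
    then show "f \<in> J j"
      using additive_subgroup.zero_closed[OF ideal.axioms(1)[OF idl]] by (simp add: J_def)
  qed
  have J0: "J 0 = I"
  proof
    have "Idl\<^bsub>?Q\<^esub> {} \<subseteq> {\<zero>\<^bsub>?Q\<^esub>}"
      by (rule ring.genideal_minimal[OF rQ ring.zeroideal[OF rQ]]) simp
    then show "J 0 \<subseteq> I" using coset_zero by (auto simp: J_def)
  qed (rule IJ)
  have set_take: "set (take (Suc j) xs) = insert (?c (y j)) (set (take j xs))"
    if "j < length xs" for j
    using that y by (simp add: take_Suc_conv_app_nth)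
  have cosetQ: "?c f \<in> carrier ?Q" if "f \<in> carrier ?R" for f
    using that by (simp add: cring.carrier_quot_image[OF cR])
  have lin: "?c a \<oplus>\<^bsub>?Q\<^esub> ?c (y j) \<otimes>\<^bsub>?Q\<^esub> ?c r = ?c (a + y j * r)"
    if "a \<in> carrier ?R" "r \<in> carrier ?R" "j < length xs" for a r j
    using cring.quot_mult[OF cR I yC[OF that(3)] that(2)]
      cring.quot_add[OF cR I that(1) mult_closed[OF yC[OF that(3)] that(2)]]
    by (simp add: mpoly_ring_simps)
  have insert_idl: "Idl\<^bsub>?Q\<^esub> (set (take (Suc j) xs))
      = {a \<oplus>\<^bsub>?Q\<^esub> ?c (y j) \<otimes>\<^bsub>?Q\<^esub> r | a r. a \<in> Idl\<^bsub>?Q\<^esub> (set (take j xs)) \<and> r \<in> carrier ?Q}"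
    if "j < length xs" for j
    unfolding set_take[OF that]
    by (rule cring.genideal_insert[OF cQ takeQ cosetQ[OF yC[OF that]]])
  have "acyclic_at (J 0) i"
  proof (rule acyclic_regular_sequence[where m = "length xs" and y = y and L = L])
    show "sub_ideal (J j)" for j by (rule Jid)
    show "J 0 \<subseteq> J j" for j unfolding J0 by (rule IJ)
    show "i + 0 < length xs" using assms by simp
    show "\<exists>a. (\<forall>l\<in>L. a l \<in> carrier ?R) \<and> y j - (\<Sum>l\<in>L. a l * g l) \<in> J 0"
      if "j < length xs" for j
      unfolding J0 using gens y that by blast
    show "f \<in> J j" if "j < length xs" "f \<in> carrier ?R" "y j * f \<in> J j" for j f
    proof -
      have "xs ! j \<otimes>\<^bsub>?Q\<^esub> ?c f \<in> Idl\<^bsub>?Q\<^esub> (set (take j xs))"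
        using that(3) cring.quot_mult[OF cR I yC[OF that(1)] that(2)] y[OF that(1)]
        by (simp add: J_def mpoly_ring_simps)
      then have "?c f \<in> Idl\<^bsub>?Q\<^esub> (set (take j xs))"
        using reg that(1) cosetQ[OF that(2)] unfolding regular_sequence_def by blast
      then show ?thesis using that(2) by (simp add: J_def)
    qed
    show "f + y j * h \<in> J (Suc j)" if "j < length xs" "f \<in> J j" "h \<in> carrier ?R" for j f h
    proof -
      have f: "f \<in> carrier ?R" "?c f \<in> Idl\<^bsub>?Q\<^esub> (set (take j xs))"
        using that(2) by (simp_all add: J_def)
      have "?c (f + y j * h) \<in> Idl\<^bsub>?Q\<^esub> (set (take (Suc j) xs))"
        unfolding insert_idl[OF that(1)] lin[OF f(1) that(3,1), symmetric]
        using f(2) cosetQ[OF that(3)] by blast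
      then show ?thesis
        using f(1) yC[OF that(1)] that(3) by (simp add: J_def)
    qed
    show "\<exists>h\<in>carrier ?R. f - y j * h \<in> J j" if j: "j < length xs" and f: "f \<in> J (Suc j)" for j f
    proof -
      have fC: "f \<in> carrier ?R" using f by (simp add: J_def)
      obtain A B where AB: "?c f = A \<oplus>\<^bsub>?Q\<^esub> ?c (y j) \<otimes>\<^bsub>?Q\<^esub> B"
          "A \<in> Idl\<^bsub>?Q\<^esub> (set (take j xs))" "B \<in> carrier ?Q"
        using f unfolding J_def insert_idl[OF j] by blast
      have "A \<in> carrier ?Q"
        using AB(2) additive_subgroup.a_subset[OF ideal.axioms(1)[OF idl]] by blast
      then obtain a r where ar: "a \<in> carrier ?R" "A = ?c a" "r \<in> carrier ?R" "B = ?c r"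
        using AB(3) unfolding cring.carrier_quot_image[OF cR] by blast
      have "?c f = ?c (a + y j * r)"
        using AB(1) lin[OF ar(1,3) j] ar by simp
      then have "f - (a + y j * r) \<in> J j"
        using coset_eq[OF fC] ar yC[OF j] IJ by auto
      moreover have "a \<in> J j" using AB(2) ar by (simp add: J_def)
      ultimately have "(f - (a + y j * r)) + a \<in> J j" by (rule sub_ideal_add[OF Jid])
      then show ?thesis using ar(3) by (intro bexI[of _ r]) (simp_all add: algebra_simps)
    qed
  qed
  then show ?thesis by (simp add: J0)
qed

text \<open>Modulo the ideal \<open>G\<close> of the \<open>point_gens\<close>, a polynomial is
  congruent to its value at the point, which here is 0.\<close>

lemma subst_kernel_generators:
  fixes n :: nat and \<sigma> :: "nat set" and f :: "'k::field mpolynomial"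
  assumes f: "f \<in> subst_kernel n (\<lambda>i. if i \<in> \<sigma> then 1 else 0)"
  shows "\<exists>a. (\<forall>l\<in>{1..n}. a l \<in> carrier (mpoly_ring n)) \<and> f = (\<Sum>l\<in>{1..n}. a l * point_gens n \<sigma> l)"
proof -
  interpret koszul "carrier (mpoly_ring n)" "point_gens n \<sigma> :: nat \<Rightarrow> 'k mpolynomial"
    by (rule koszul_point_gens)
  let ?P = "\<lambda>a. \<Sum>l\<in>{1..n}. a l * point_gens n \<sigma> l :: 'k mpolynomial"
  let ?C = "carrier (mpoly_ring n) :: 'k mpolynomial set"
  define G where "G = {?P a | a. \<forall>l\<in>{1..n}. a l \<in> ?C}"
  have GI: "?P a \<in> G" if "\<forall>l\<in>{1..n}. a l \<in> ?C" for a
    unfolding G_def using that by blast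
  have Gid: "sub_ideal G"
    unfolding sub_ideal_def
  proof (intro conjI ballI)
    show "G \<subseteq> ?C" by (auto simp: G_def intro!: sum_closed mult_closed)
    show "0 \<in> G" using GI[of "\<lambda>_. 0"] by simp
    fix p assume "p \<in> G"
    then obtain a where a: "p = ?P a" "\<forall>l\<in>{1..n}. a l \<in> ?C" unfolding G_def by blast
    show "p + q \<in> G" if q: "q \<in> G" for q
    proof -
      obtain b where b: "q = ?P b" "\<forall>l\<in>{1..n}. b l \<in> ?C" using q unfolding G_def by blast
      then show ?thesis using a GI[of "\<lambda>l. a l + b l"] by (simp add: distrib_right sum.distrib)
    qed
    show "r * p \<in> G" if "r \<in> ?C" for r
    proof -
      show ?thesis using a that GI[of "\<lambda>l. r * a l"] by (simp add: sum_distrib_left mult.assoc)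
    qed
  qed
  have var: "mpoly_var i - (if i \<in> \<sigma> then 1 else 0) \<in> G" if i: "i \<in> {1..n}" for i
  proof -
    have "?P (\<lambda>l. if l = i then 1 else 0) \<in> G"
      by (rule GI) simp
    moreover have "?P (\<lambda>l. if l = i then 1 else 0)
        = (\<Sum>l\<in>{1..n}. if l = i then point_gens n \<sigma> l else 0)"
      by (rule sum.cong) auto
    moreover have "\<dots> = point_gens n \<sigma> i" using i by simp
    ultimately show ?thesis using i by (simp add: point_gens_def)
  qed
  have "f - subst (\<lambda>i. if i \<in> \<sigma> then 1 else 0) f \<in> G"
    by (rule subst_diff_mem[OF _ Gid _ var])
      (use f in \<open>auto simp: subst_kernel_def one_mpoly_carrier zero_mpoly_carrier\<close>)
  then show ?thesis using f unfolding G_def subst_kernel_def by auto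
qed

text \<open>The support of a nonface monomial leaves \<open>F\<close>, so the monomial has a factor
  that \<open>h\<close> sends to 0.\<close>

lemma link_ideal_subset_subst_kernel:
  assumes "simplicial_complex n \<Delta>" "F \<in> \<Delta>" "\<And>i. i \<notin> F \<Longrightarrow> h i = 0"
  shows "link_ideal n \<Delta> {} \<subseteq> subst_kernel n h"
proof
  fix p :: "'a mpolynomial" assume p: "p \<in> link_ideal n \<Delta> {}"
  have "monom_ev h m = 0" if "m \<in> Poly_Mapping.keys p" for m
  proof -
    have "Poly_Mapping.keys m \<notin> \<Delta>"
      using p that by (simp add: link_ideal_def nonface_ideal_def)
    then obtain i where i: "i \<in> Poly_Mapping.keys m" "i \<notin> F"
      using face_subset[OF assms(1,2)] by blast
    then show ?thesis
      unfolding monom_ev_def using assms(3)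
      by (intro prod_zero finite_keys bexI[OF _ i(1)]) (simp add: in_keys_iff)
  qed
  then show "p \<in> subst_kernel n h"
    using p by (simp add: subst_kernel_def link_ideal_def subst_def)
qed

text \<open>
  The substitutions of the chain: the variables outside \<open>F\<close> vanish from the start, and the variables
  of \<open>F\<close> specialise one after the other to the coordinates of the indicator point of \<open>\<sigma>\<close>.
\<close>

lemma face_prime_chain:
  fixes \<Delta> :: "nat set set"
  assumes complex: "simplicial_complex n \<Delta>" and F: "F \<in> \<Delta>" "\<sigma> \<subseteq> F"
  obtains K :: "nat \<Rightarrow> 'k::field mpolynomial set" where
    "\<And>r. primeideal (K r) (mpoly_ring n)" "\<And>r. link_ideal n \<Delta> {} \<subseteq> K r"
    "\<And>r. r < card F \<Longrightarrow> K r \<subset> K (Suc r)"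
    "K (card F) = subst_kernel n (\<lambda>i. if i \<in> \<sigma> then 1 else 0)"
proof -
  have FC: "F \<subseteq> {1..n}" using complex F unfolding simplicial_complex_def by blast
  then have "finite F" using finite_subset by blast
  then obtain e where e: "bij_betw e {0..<card F} F" using ex_bij_betw_nat_finite by blast
  let ?c = "\<lambda>i. if i \<in> \<sigma> then 1 else 0 :: 'k mpolynomial"
  \<comment> \<open>The minimum keeps \<open>T r\<close> inside \<open>F\<close> for every
    \<open>r\<close>, as \<open>e\<close> is controlled only below \<open>card F\<close>.\<close>
  define T where "T r = e ` {0..<min r (card F)}" for r
  define h where "h r i = (if i \<in> T r then ?c i else if i \<in> F then mpoly_var i else 0)" for r i
  have TF: "T r \<subseteq> F" for r using e by (auto simp: T_def bij_betw_def)
  have Tend: "T (card F) = F" using e by (simp add: T_def bij_betw_def)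
  have strict: "subst_kernel n (h r) \<subset> subst_kernel n (h (Suc r))" if r: "r < card F" for r
  proof -
    have TS: "T (Suc r) = insert (e r) (T r)"
      using r by (auto simp: T_def min_def atLeast0_lessThan_Suc less_Suc_eq)
    have er: "e r \<in> F" using e r by (auto simp: bij_betw_def)
    have enot: "e r \<notin> T r"
    proof
      assume "e r \<in> T r"
      then obtain j where "j < r" "e r = e j" using r by (auto simp: T_def)
      then show False
        using inj_onD[OF bij_betw_imp_inj_on[OF e], of r j] r by simp
    qed
    \<comment> \<open>One more specialisation is a composition of substitutions, so the kernels
      grow. The growth is strict by x_(e r) minus its coordinate, which \<open>h r\<close> still
      fixes.\<close>
    have hS: "h (Suc r) = (\<lambda>i. subst (\<lambda>j. if j = e r then ?c j else mpoly_var j) (h r i))"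
      using er enot by (auto simp: h_def TS fun_eq_iff)
    have "subst_kernel n (h r) \<subseteq> subst_kernel n (h (Suc r))"
      by (auto simp: subst_kernel_def hS simp flip: subst_subst)
    moreover have "mpoly_var (e r) - ?c (e r) \<in> subst_kernel n (h (Suc r))"
      using er FC by (auto simp: subst_kernel_def subst_diff h_def TS diff_mpoly_carrier one_mpoly_carrier
          zero_mpoly_carrier var_mpoly_carrier subset_iff)
    moreover have "mpoly_var (e r) - ?c (e r) \<notin> subst_kernel n (h r)"
    proof -
      have "mpoly_var (e r) - ?c (e r) \<noteq> 0"
      proof
        assume "mpoly_var (e r) - ?c (e r) = 0"
        then have "Poly_Mapping.lookup (mpoly_var (e r) - ?c (e r)) (Poly_Mapping.single (e r) 1) = 0"
          by simp
        moreover have "Poly_Mapping.single (e r) (1::nat) \<noteq> 0"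
          by (metis lookup_single_eq lookup_zero one_neq_zero)
        ultimately show False
          by (simp add: mpoly_var_def lookup_minus lookup_one split: if_splits)
      qed
      moreover have "subst (h r) (mpoly_var (e r) - ?c (e r)) = mpoly_var (e r) - ?c (e r)"
        using er enot by (simp add: subst_diff h_def)
      ultimately show ?thesis by (simp add: subst_kernel_def)
    qed
    ultimately show ?thesis by blast
  qed
  have hF: "h r i = 0" if "i \<notin> F" for r i using that TF by (auto simp: h_def)
  have "h (card F) = ?c"
    by (rule ext) (use F(2) in \<open>auto simp: h_def Tend\<close>)
  then have "subst_kernel n (h (card F)) = subst_kernel n ?c" by simp
  moreover have "link_ideal n \<Delta> {} \<subseteq> subst_kernel n (h r)" for r
    by (rule link_ideal_subset_subst_kernel[OF complex F(1)]) (rule hF)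
  ultimately show ?thesis
    using that[of "\<lambda>r. subst_kernel n (h r)"] primeideal_subst_kernel strict by blast
qed

text \<open>The point lies in the coordinate subspace of \<open>F\<close>, so the chain of
  \<open>face_prime_chain\<close> has \<open>card F\<close> steps and yields at least as many
  regular elements in its maximal ideal.\<close>

lemma acyclic_of_cohen_macaulay:
  fixes \<Delta> :: "nat set set"
  assumes cm: "cohen_macaulay_complex TYPE('k::field) n \<Delta>" and F: "F \<in> \<Delta>" "\<sigma> \<subseteq> F"
    and "i < card F"
  shows "koszul.acyclic_at (carrier (mpoly_ring n)) (point_gens n \<sigma> :: nat \<Rightarrow> 'k mpolynomial)
    (link_ideal n \<Delta> {}) i"
proof -
  let ?S = "mpoly_ring n :: 'k mpolynomial ring"
  let ?I = "link_ideal n \<Delta> {} :: 'k mpolynomial set"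
  let ?M = "subst_kernel n (\<lambda>i. if i \<in> \<sigma> then 1 else 0) :: 'k mpolynomial set"
  let ?im = "\<lambda>K. (+>\<^bsub>?S\<^esub>) ?I ` K"
  have complex: "simplicial_complex n \<Delta>"
    using cm by (simp add: cohen_macaulay_complex_def)
  have R: "cohen_macaulay_ring (?S Quot ?I)"
    using cm by (simp add: cohen_macaulay_complex_def stanley_reisner_ring_def
        stanley_reisner_ideal_eq[OF complex])
  have I: "ideal ?I ?S"
    unfolding ideal_mpoly_ring_iff by (rule sub_ideal_link_ideal[OF complex])
  obtain K :: "nat \<Rightarrow> 'k mpolynomial set" where K: "\<And>r. primeideal (K r) ?S" "\<And>r. ?I \<subseteq> K r"
      "\<And>r. r < card F \<Longrightarrow> K r \<subset> K (Suc r)" "K (card F) = ?M"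
    using face_prime_chain[OF complex F, where 'k = 'k] by metis
  have KC: "K r \<subseteq> carrier ?S" for r
    using additive_subgroup.a_subset[OF ideal.axioms(1)[OF primeideal.axioms(1)[OF K(1)]]] .
  have "maximalideal ?M ?S"
    by (rule maximalideal_subst_kernel[where c = "\<lambda>i. if i \<in> \<sigma> then 1 else 0"]) simp
  then have max: "maximalideal (?im ?M) (?S Quot ?I)"
    using cring.maximalideal_quot[OF cring_mpoly I] K(2,4) by metis
  have prime: "primeideal (?im (K r)) (?S Quot ?I)" for r
    by (rule cring.primeideal_quot[OF cring_mpoly I K(1,2)])
  have mem: "I_a \<in> ?im (K r) \<longleftrightarrow> a \<in> K r"
    if "a \<in> carrier ?S" "I_a = ?I +>\<^bsub>?S\<^esub> a" for a r I_a
    using cring.coset_mem_image_iff[OF cring_mpoly I primeideal.axioms(1)[OF K(1)] K(2) that(1)]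
      that(2) by simp
  have chain: "?im (K r) \<subset> ?im (K (Suc r))" if r: "r < card F" for r
  proof -
    obtain a where a: "a \<in> K (Suc r)" "a \<notin> K r" using K(3)[OF r] by blast
    then have "?I +>\<^bsub>?S\<^esub> a \<in> ?im (K (Suc r))" "?I +>\<^bsub>?S\<^esub> a \<notin> ?im (K r)"
      using mem KC by blast+
    moreover have "?im (K r) \<subseteq> ?im (K (Suc r))" using K(3)[OF r] by (intro image_mono) blast
    ultimately show ?thesis by blast
  qed
  obtain xs where xs: "regular_sequence (?S Quot ?I) xs" "set xs \<subseteq> ?im ?M" "card F \<le> length xs"
    using regular_sequence_of_chain[OF R max, of "card F" "\<lambda>r. ?im (K r)"] prime chain K(4) by metis
  show ?thesis
  proof (rule acyclic_of_regular_sequence[OF I _ xs(1) _ xs(2), where L = "{1..n}"])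
    show "?M \<subseteq> carrier ?S" by (auto simp: subst_kernel_def)
    show "\<exists>a. (\<forall>l\<in>{1..n}. a l \<in> carrier ?S) \<and> f - (\<Sum>l\<in>{1..n}. a l * point_gens n \<sigma> l) \<in> ?I"
      if f: "f \<in> ?M" for f
    proof -
      obtain a where "\<forall>l\<in>{1..n}. a l \<in> carrier ?S" "f = (\<Sum>l\<in>{1..n}. a l * point_gens n \<sigma> l)"
        using subst_kernel_generators[OF f] by blast
      moreover have "0 \<in> ?I"
        using additive_subgroup.zero_closed[OF ideal.axioms(1)[OF I]] by (simp add: mpoly_ring_simps)
      ultimately show ?thesis by (intro exI[of _ a]) simp
    qed
    show "i < length xs" using \<open>i < card F\<close> xs(3) by simp
  qed (rule point_gens_carrier)
qed

section \<open>Facets\<close>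

definition facets :: "'a set set \<Rightarrow> 'a set set" where
  "facets \<Delta> = {F \<in> \<Delta>. \<forall>G\<in>\<Delta>. F \<subseteq> G \<longrightarrow> G = F}"

lemma facets_subset: "facets \<Delta> \<subseteq> \<Delta>"
  by (auto simp: facets_def)

lemma ex_facet:
  assumes "finite \<Delta>" "F \<in> \<Delta>"
  obtains G where "G \<in> facets \<Delta>" "F \<subseteq> G"
proof -
  obtain G where "G \<in> \<Delta>" "F \<subseteq> G" "\<forall>H\<in>\<Delta>. G \<subseteq> H \<longrightarrow> G = H"
    using finite_has_maximal2[OF assms] by auto
  then show ?thesis using that[of G] by (auto simp: facets_def)
qed

text \<open>
  If the facets in \<open>A\<close> met the other ones only in codimension two or more, the link of a
  largest such intersection would be disconnected.
\<close>

lemma cohen_macaulay_facet_adjacent: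
  fixes \<Delta> :: "nat set set"
  assumes cm: "cohen_macaulay_complex TYPE('k::field) n \<Delta>"
    and A: "A \<subseteq> facets \<Delta>" "A \<noteq> {}" "A \<noteq> facets \<Delta>" "\<And>F. F \<in> A \<Longrightarrow> card F = d"
  obtains F G where "F \<in> A" "G \<in> facets \<Delta> - A" "d \<le> Suc (card (F \<inter> G))"
proof (rule ccontr)
  assume no: "\<not> thesis"
  have complex: "simplicial_complex n \<Delta>"
    using cm by (simp add: cohen_macaulay_complex_def)
  then have sub: "\<Delta> \<subseteq> Pow {1..n}" by (simp add: simplicial_complex_def)
  then have finD: "finite \<Delta>" by (rule finite_subset) simp
  have finF: "finite F" if "F \<in> \<Delta>" for F using sub that finite_subset by blast
  let ?N = "(\<lambda>(F, G). card (F \<inter> G)) ` (A \<times> (facets \<Delta> - A))"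
  have "finite (A \<times> (facets \<Delta> - A))"
    using finD facets_subset A(1) by (meson finite_Diff finite_SigmaI finite_subset)
  then have finN: "finite ?N" by blast
  have "?N \<noteq> {}" using A by blast
  then have "Max ?N \<in> ?N" using Max_in finN by blast
  then obtain F G where FG: "F \<in> A" "G \<in> facets \<Delta>" "G \<notin> A" "card (F \<inter> G) = Max ?N" by auto
  define \<sigma> where "\<sigma> = F \<inter> G"
  have max: "card (H \<inter> H') \<le> card \<sigma>" if "H \<in> A" "H' \<in> facets \<Delta>" "H' \<notin> A" for H H'
    unfolding \<sigma>_def FG(4) using that by (intro Max_ge finN) force
  have AD: "H \<in> \<Delta>" "finite H" if "H \<in> A" for H using A(1) facets_subset finF that by blast+
  \<comment> \<open>By maximality of \<sigma>, a facet in \<open>A\<close> and one outside it that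
    both contain \<sigma> share no further vertex.\<close>
  have bigger: False if "H \<in> A" "H' \<in> facets \<Delta>" "H' \<notin> A" "\<sigma> \<subseteq> H \<inter> H'" "i \<in> H \<inter> H'" "i \<notin> \<sigma>" for H H' i
  proof -
    have "card \<sigma> < card (H \<inter> H')"
      using that AD by (intro psubset_card_mono) auto
    then show False using max[OF that(1-3)] by simp
  qed
  have FD: "F \<in> \<Delta>" and GD: "G \<in> \<Delta>" using AD FG facets_subset by blast+
  have \<sigma>n: "\<sigma> \<subseteq> {1..n}" using FD sub by (auto simp: \<sigma>_def)
  \<comment> \<open>Two vertices are lost across the cut, so degree one survives
    \<open>card \<sigma>\<close> divisions.\<close>
  have d: "Suc (card \<sigma>) < d"
    using no that FG(1-3) by (force simp: \<sigma>_def)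
  have "koszul.acyclic_at (carrier (mpoly_ring n)) (point_gens n \<sigma> :: nat \<Rightarrow> 'k mpolynomial)
      (link_ideal n \<Delta> {}) i" if "i < d" for i
    by (rule acyclic_of_cohen_macaulay[OF cm FD]) (use A(4) FG that in \<open>auto simp: \<sigma>_def\<close>)
  then have "koszul.acyclic_at (carrier (mpoly_ring n)) (point_gens n \<sigma> :: nat \<Rightarrow> 'k mpolynomial)
      (link_ideal n \<Delta> \<sigma>) 1"
    using d by (intro acyclic_link_ideal[OF complex point_gens_carrier \<sigma>n]) auto
  \<comment> \<open>The vertices of the link that lie on facets from \<open>A\<close>: one side of
    the disconnection.\<close>
  moreover define B where "B = {i. i \<notin> \<sigma> \<and> (\<exists>H\<in>A. \<sigma> \<subseteq> H \<and> i \<in> H)}"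
  have "\<exists>a. a \<in> F - \<sigma>"
  proof (rule ccontr)
    assume "\<nexists>a. a \<in> F - \<sigma>"
    then have "F = \<sigma>" by (auto simp: \<sigma>_def)
    then show False using A(4)[OF FG(1)] d by simp
  qed
  then obtain a where a: "a \<in> F" "a \<notin> \<sigma>" by blast
  have "\<not> G \<subseteq> F" using FG FD by (auto simp: facets_def)
  then obtain b where b: "b \<in> G" "b \<notin> \<sigma>" by (auto simp: \<sigma>_def)
  have "\<not> koszul.acyclic_at (carrier (mpoly_ring n)) (point_gens n \<sigma> :: nat \<Rightarrow> 'k mpolynomial)
      (link_ideal n \<Delta> \<sigma>) 1"
  proof (rule disconnected_link_not_acyclic[OF complex, where A = B and a = a and b = b])
    show "B \<subseteq> {1..n}" using AD sub unfolding B_def by blast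
    show "B \<inter> \<sigma> = {}" by (auto simp: B_def)
    show "a \<in> B" using a FG(1) by (auto simp: B_def \<sigma>_def)
    show "insert a \<sigma> \<in> \<Delta>" using a by (intro face_subset[OF complex FD]) (auto simp: \<sigma>_def)
    show "b \<in> {1..n}" using b(1) GD sub by blast
    show "b \<notin> \<sigma>" by (rule b(2))
    show "insert b \<sigma> \<in> \<Delta>" using b by (intro face_subset[OF complex GD]) (auto simp: \<sigma>_def)
    show "b \<notin> B"
    proof
      assume "b \<in> B"
      then obtain H where H: "H \<in> A" "\<sigma> \<subseteq> H" "b \<in> H" by (auto simp: B_def)
      show False
        by (rule bigger[OF H(1) FG(2,3), of b]) (use H b in \<open>auto simp: \<sigma>_def\<close>)
    qed
    show "insert i (insert j \<sigma>) \<notin> \<Delta>"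
      if ij: "i \<in> B" "j \<in> {1..n}" "j \<notin> B" "j \<notin> \<sigma>" for i j
    proof
      \<comment> \<open>A facet over this edge contains \<open>j\<close>, so it is outside
        \<open>A\<close>, yet it shares \<open>i\<close> with a facet in \<open>A\<close>, contrary
        to \<open>bigger\<close>.\<close>
      assume "insert i (insert j \<sigma>) \<in> \<Delta>"
      then obtain H' where H': "H' \<in> facets \<Delta>" "insert i (insert j \<sigma>) \<subseteq> H'"
        by (rule ex_facet[OF finD])
      then have "H' \<notin> A" using ij by (auto simp: B_def)
      obtain H where H: "H \<in> A" "\<sigma> \<subseteq> H" "i \<in> H" "i \<notin> \<sigma>" using ij(1) by (auto simp: B_def)
      show False
        by (rule bigger[OF H(1) H'(1) \<open>H' \<notin> A\<close>, of i]) (use H H' in auto)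
    qed
  qed
  ultimately show False by blast
qed

text \<open>Facets are collected one at a time, always one adjacent to an earlier facet. The strict
  bound starts as \<open>d < d + 1\<close>, and each new facet adds one to the count while removing
  at most one common vertex.\<close>

lemma cohen_macaulay_Inter_facets:
  fixes \<Delta> :: "nat set set"
  assumes cm: "cohen_macaulay_complex TYPE('k::field) n \<Delta>"
    and F0: "F0 \<in> facets \<Delta>" "card F0 = d"
    and dim: "\<And>F. F \<in> \<Delta> \<Longrightarrow> card F \<le> d"
  shows "(\<forall>F\<in>facets \<Delta>. card F = d) \<and> d < card (\<Inter> (facets \<Delta>)) + card (facets \<Delta>)"
proof -
  have complex: "simplicial_complex n \<Delta>"
    using cm by (simp add: cohen_macaulay_complex_def)
  then have sub: "\<Delta> \<subseteq> Pow {1..n}" by (simp add: simplicial_complex_def)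
  then have finD: "finite \<Delta>" by (rule finite_subset) simp
  have fin: "finite (facets \<Delta>)" by (rule finite_subset[OF facets_subset finD])
  have finF: "finite F" if "F \<in> facets \<Delta>" for F
  proof (rule finite_subset)
    show "F \<subseteq> {1..n}" using that facets_subset[of \<Delta>] sub by auto
  qed simp
  have step: "\<exists>X. X \<subseteq> facets \<Delta> \<and> card X = Suc k \<and> (\<forall>F\<in>X. card F = d) \<and>
      d < card (\<Inter> X) + Suc k" if "k < card (facets \<Delta>)" for k
    using that
  proof (induction k)
    case 0
    show ?case using F0 by (intro exI[of _ "{F0}"]) simp
  next
    case (Suc k)
    then obtain X where X: "X \<subseteq> facets \<Delta>" "card X = Suc k" "\<And>F. F \<in> X \<Longrightarrow> card F = d"
        "d < card (\<Inter> X) + Suc k" by auto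
    have "X \<noteq> {}" "X \<noteq> facets \<Delta>" using X(2) Suc.prems by auto
    then obtain F G where FG: "F \<in> X" "G \<in> facets \<Delta> - X" "d \<le> Suc (card (F \<inter> G))"
      using cohen_macaulay_facet_adjacent[OF cm X(1) _ _ X(3)] by metis
    have F: "F \<in> facets \<Delta>" using FG X by blast
    have finX: "finite X" using X(1) fin finite_subset by blast
    have fF: "finite F" and fG: "finite G" using finF F FG by blast+
    \<comment> \<open>Distinct facets are incomparable, so the intersection, of size at least
      \<open>d - 1\<close>, is proper in both. This gives \<open>G\<close> at least \<open>d\<close>
      elements, and \<open>dim\<close> makes it exactly \<open>d\<close>.\<close>
    have "F \<inter> G \<subset> G"
      using F FG by (auto simp: facets_def)
    then have "card (F \<inter> G) < card G" by (rule psubset_card_mono[OF fG])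
    moreover have "F \<inter> G \<subset> F" using F FG by (auto simp: facets_def)
    then have "card (F \<inter> G) < card F" by (rule psubset_card_mono[OF fF])
    ultimately have "d \<le> card G" "card (F - G) \<le> 1"
      using FG(3) X(3)[OF FG(1)] card_Diff_subset_Int[of F G] fF by auto
    have "card G = d"
      using \<open>d \<le> card G\<close> dim[of G] FG(2) facets_subset[of \<Delta>] by auto
    have "card (\<Inter> X) \<le> card (\<Inter> X \<inter> G) + card (F - G)"
    proof -
      \<comment> \<open>As \<open>F\<close> is in \<open>X\<close>, common vertices that
        \<open>G\<close> misses lie in \<open>F - G\<close>.\<close>
      have "\<Inter> X \<subseteq> (\<Inter> X \<inter> G) \<union> (F - G)" using FG(1) by blast
      moreover have "finite ((\<Inter> X \<inter> G) \<union> (F - G))" using fF fG by blast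
      ultimately have "card (\<Inter> X) \<le> card ((\<Inter> X \<inter> G) \<union> (F - G))" by (intro card_mono)
      also have "\<dots> \<le> card (\<Inter> X \<inter> G) + card (F - G)" by (rule card_Un_le)
      finally show ?thesis .
    qed
    then have "d < card (\<Inter> (insert G X)) + Suc (Suc k)"
      using X(4) \<open>card (F - G) \<le> 1\<close> by (simp add: Int_commute)
    moreover have "card (insert G X) = Suc (Suc k)" using FG(2) finX X(2) by simp
    ultimately show ?case
      using X FG \<open>card G = d\<close> by (intro exI[of _ "insert G X"]) auto
  qed
  have "0 < card (facets \<Delta>)" using F0 fin card_gt_0_iff by blast
  then obtain X where "X \<subseteq> facets \<Delta>" "card X = card (facets \<Delta>)" "\<forall>F\<in>X. card F = d"
      "d < card (\<Inter> X) + card (facets \<Delta>)"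
    using step[of "card (facets \<Delta>) - 1"] by auto
  moreover from this have "X = facets \<Delta>" using card_subset_eq[OF fin] by blast
  ultimately show ?thesis by simp
qed

section \<open>Counting the facets with the f-polynomial\<close>

lemma coeff_f_polynomial:
  "r \<le> n \<Longrightarrow> coeff (f_polynomial n \<Delta>) r = int (card {F \<in> \<Delta>. card F = r})"
  by (simp add: f_polynomial_def coeff_sum coeff_monom)

theorem proposition4p8:
  fixes n s :: nat and \<Delta> :: "nat set set"
  assumes "bi_cohen_macaulay_of_type TYPE('k::field) \<Delta> n 1 s"
    and "\<not> is_cone n \<Delta>"
  shows "int n - int s \<le> int s - 2"
proof -
  have cm: "cohen_macaulay_complex TYPE('k) n \<Delta>"
    and size1: "1 \<in> full_skeleton_sizes n \<Delta>" and "s \<le> n"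
    and f: "f_polynomial n \<Delta> = [:1, 1:] ^ (n - s) * (\<Sum>i\<le>1. monom (int (s choose i)) i)"
    using assms(1) by (simp_all add: bi_cohen_macaulay_of_type_def bi_cohen_macaulay_def)
  have complex: "simplicial_complex n \<Delta>"
    using cm by (simp add: cohen_macaulay_complex_def)
  then have sub: "\<Delta> \<subseteq> Pow {1..n}" by (simp add: simplicial_complex_def)
  then have fin: "finite \<Delta>" by (rule finite_subset) simp
  have "1 \<le> n" using size1 by (simp add: full_skeleton_sizes_def)
  have "(\<Sum>i\<le>1. monom (int (s choose i)) i) = [:1, int s:]"
    by (simp add: monom_altdef)
  then have f: "f_polynomial n \<Delta> = [:1, 1:] ^ (n - s) * [:1, int s:]" using f by simp
  define d where "d = Suc (n - s)"
  have deg: "degree ([:1, 1:] ^ (n - s) :: int poly) = n - s"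
    by (simp add: degree_power_eq)
  have lead: "coeff ([:1, 1:] ^ (n - s) :: int poly) (n - s) = 1"
    using lead_coeff_power[of "[:1, 1 :: int:]" "n - s"] deg by simp
  \<comment> \<open>For \<open>s = 0\<close> the f-polynomial is (1 + t)^n, so \<Delta> is the full
    simplex. This is a cone over vertex 1, which exists because type \<open>c = 1\<close> forces
    \<open>1 \<le> n\<close>.\<close>
  have "s \<noteq> 0"
  proof
    assume "s = 0"
    then have "coeff (f_polynomial n \<Delta>) n = 1" using f lead by (simp add: mult.commute)
    then have "card {F \<in> \<Delta>. card F = n} = 1" by (simp add: coeff_f_polynomial)
    then obtain F where F: "F \<in> \<Delta>" "card F = n" by (auto simp: card_1_singleton_iff)
    then have "F = {1..n}" using sub by (intro card_subset_eq) auto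
    then have "is_cone n \<Delta>"
      unfolding is_cone_def using F(1) sub \<open>1 \<le> n\<close>
      by (intro bexI[of _ 1] ballI face_subset[OF complex F(1)]) auto
    then show False using assms(2) by simp
  qed
  then have "d \<le> n" using \<open>s \<le> n\<close> by (simp add: d_def)
  have degs: "degree [:1, int s:] = 1" using \<open>s \<noteq> 0\<close> by simp
  \<comment> \<open>The leading coefficient is the product of those of the two factors, 1 and
    \<open>s\<close>; it counts the faces of top size \<open>d\<close>.\<close>
  have "coeff (f_polynomial n \<Delta>) (n - s + 1) = 1 * coeff [:1, int s:] 1"
    using coeff_mult_degree_sum[of "[:1, 1:] ^ (n - s) :: int poly" "[:1, int s:]"]
    by (simp only: f deg degs lead)
  then have "coeff (f_polynomial n \<Delta>) d = int s" by (simp add: d_def)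
  then have card_d: "card {F \<in> \<Delta>. card F = d} = s"
    using \<open>d \<le> n\<close> by (simp add: coeff_f_polynomial)
  have dim: "card F \<le> d" if "F \<in> \<Delta>" for F
  proof (rule ccontr)
    assume "\<not> card F \<le> d"
    moreover have "degree (f_polynomial n \<Delta>) \<le> d"
      unfolding f d_def using degree_mult_le[of "[:1, 1:] ^ (n - s)" "[:1, int s:]"]
      by (simp only: deg degs Suc_eq_plus1)
    ultimately have "coeff (f_polynomial n \<Delta>) (card F) = 0" by (intro coeff_eq_0) simp
    moreover have "card F \<le> n" using card_mono[of "{1..n}" F] sub that by auto
    ultimately have "card {G \<in> \<Delta>. card G = card F} = 0" by (simp add: coeff_f_polynomial)
    then show False using fin that by auto
  qed
  have "{F \<in> \<Delta>. card F = d} \<noteq> {}" using card_d \<open>s \<noteq> 0\<close> by force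
  then obtain F where F: "F \<in> \<Delta>" "card F = d" by blast
  obtain F0 where F0: "F0 \<in> facets \<Delta>" "F \<subseteq> F0" by (rule ex_facet[OF fin F(1)])
  have F0D: "F0 \<in> \<Delta>" using F0(1) facets_subset by blast
  then have F0n: "F0 \<subseteq> {1..n}" using sub by blast
  have "card F0 = d"
    using card_mono[OF finite_subset[OF F0n] F0(2)] F(2) dim[OF F0D] by simp
  then have card: "\<forall>F\<in>facets \<Delta>. card F = d"
    and Inter: "d < card (\<Inter> (facets \<Delta>)) + card (facets \<Delta>)"
    using cohen_macaulay_Inter_facets[OF cm F0(1) _ dim] by simp_all
  \<comment> \<open>A vertex common to all facets would be an apex, since every face extends to a
    facet.\<close>
  have "\<Inter> (facets \<Delta>) = {}"
  proof (rule ccontr)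
    assume "\<Inter> (facets \<Delta>) \<noteq> {}"
    then obtain i where i: "i \<in> \<Inter> (facets \<Delta>)" by blast
    have "G \<union> {i} \<in> \<Delta>" if G: "G \<in> \<Delta>" for G
    proof -
      obtain H where H: "H \<in> facets \<Delta>" "G \<subseteq> H" by (rule ex_facet[OF fin G])
      then have "H \<in> \<Delta>" using facets_subset by blast
      then show ?thesis by (rule face_subset[OF complex]) (use H i in auto)
    qed
    moreover have "i \<in> {1..n}" using i F0(1) F0n by blast
    ultimately show False using assms(2) unfolding is_cone_def by blast
  qed
  moreover have "card (facets \<Delta>) \<le> s"
  proof -
    have "facets \<Delta> \<subseteq> {F \<in> \<Delta>. card F = d}" using card facets_subset by auto
    then show ?thesis unfolding card_d[symmetric] using fin by (intro card_mono) auto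
  qed
  \<comment> \<open>The empty intersection leaves \<open>d < card (facets \<Delta>) \<le> s\<close>
    with \<open>d = n - s + 1\<close>; the strictness gives the 2 of the claim.\<close>
  ultimately have "d < s" using Inter by simp
  then show ?thesis using \<open>s \<le> n\<close> by (simp add: d_def)
qed

end
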